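(* Let $\mathbb{G}$ be a Carnot group and let $E\in V_1$ with $\omega(E)=1$ be deformable. Then the Carnot-Carathéodory distance is differentiable at $\exp(E)$.
   Context: A Carnot group $\mathbb{G}$ of step $s$ is a simply connected Lie group whose Lie algebra $\mathfrak g$ decomposes as $\mathfrak g=V_1\oplus\cdots\oplus V_s$ with $V_i=[V_1,V_{i-1}]$ for $i=2,\dots,s$ and $[V_1,V_s]=0$. $V_1$ is the horizontal layer and $r=\dim V_1$; elements of $V_1$ are regarded as left-invariant vector fields. Fix a basis $X_1,\dots,X_n$ of $\mathfrak g$ adapted to the stratification ($X_1,\dots,X_r$ is a basis of $V_1$), and identify $\mathbb{G}$ with $\mathbb{R}^n$ by $(x_1,\dots,x_n)\leftrightarrow\exp(x_1X_1+\cdots+x_nX_n)$ (the identity is $0$). Let $\omega$ be the inner product norm on $V_1$ making $X_1,\dots,X_r$ orthonormal. Let $p(x)=(x_1,\dots,x_r)$ for $x\in\mathbb{G}$, and $p(E)=(a_1,\dots,a_r)$ for $E=\sum_{i\le r}a_iX_i\in V_1$; then $\omega(E)=|p(E)|$ and $\exp(E)=E(0)=(p(E),0)\in\mathbb{R}^n$. $\langle\cdot,\cdot\rangle$ is the Euclidean inner product in coordinates. Dilations: $\delta_\lambda(\exp(\sum_iY_i))=\exp(\sum_i\lambda^iY_i)$ for $\lambda>0$, $Y_i\in V_i$. An absolutely continuous curve $\gamma:[a,b]\to\mathbb{G}$ is horizontal if $\gamma'(t)=\sum_{j=1}^r u_j(t)X_j(\gamma(t))$ for a.e. $t$ with $u_j\in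 L^1[a,b]$; its length is $\int_a^b|u|$. The Carnot-Carathéodory (CC) distance $d(x,y)$ is the infimum of lengths of horizontal curves joining $x$ to $y$; $d(x)=d(x,0)$, and differentiability of the CC distance refers to the function $x\mapsto d(x)$. $\mathrm{Lip}_{\mathbb{G}}$ is the Lipschitz constant with respect to $d$. Horizontal lines are curves $t\mapsto q\exp(tV)$ with $q\in\mathbb{G}$, $V\in V_1$. A curve is formed by joining at most $N$ horizontal lines if its domain can be divided into at most $N$ consecutive intervals on each of which it coincides with a horizontal line. $L:\mathbb{G}\to\mathbb{R}$ is $\mathbb{G}$-linear if $L(xy)=L(x)+L(y)$ and $L(\delta_\lambda(x))=\lambda L(x)$ for all $x,y\in\mathbb{G}$, $\lambda>0$. A map $f:\mathbb{G}\to\mathbb{R}$ is (Pansu) differentiable at $x$ if there is a $\mathbb{G}$-linear $L$ with $\lim_{y\to x}|f(y)-f(x)-L(x^{-1}y)|/d(x,y)=0$. $E\in V_1$ with $\omega(E)=1$ is deformable if there exist a positive constant $C_E$, a positive integer $N_E$ and a map $\Delta_E:(0,\infty)\to(0,\infty)$ such that for every $0<\ell<1$, $\eta\in(0,\infty)$, $0<\Delta<\Delta_E(\eta)$ and $u\in\mathbb{G}$ with $d(u)\le1$, there is a Lipschitz horizontal curve $g:\mathbb{R}\to\mathbb{G}$ formed by joining at most $N_E$ horizontal lines such that: (1) $g(t)=\exp(tE)$ for $|t|\ge \ell$; (2) $g(\zeta)=\delta_{\Delta \ell}(u)$ where $\zeta:=\langle\delta_{\Delta \ell}(u),E(0)\rangle$;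 (3) $\mathrm{Lip}_{\mathbb{G}}(g)\le1+\eta\Delta$; (4) $|(p\circ g)'(t)-p(E)|\le C_E\Delta$ for all but finitely many $t\in\mathbb{R}$. *)

theory Defs
  imports "HOL-Analysis.Analysis" "HOL-Library.Disjoint_Sets"
begin

section \<open>Carnot groups in exponential coordinates\<close>

text \<open>
  A Carnot group is presented in exponential coordinates of the first kind with respect to a basis
  \<open>(X\<^sub>i)\<close> of the Lie algebra adapted to the stratification. The underlying manifold is
  \<^typ>\<open>real ^ 'n\<close>, the group law is a smooth map \<open>m\<close>, and the point \<open>x\<close> is
  \<open>exp (\<Sum>i. x\<^sub>i X\<^sub>i)\<close>. The Lie algebra consists of the left-invariant vector fields, each
  represented by its value at the identity \<open>0\<close>; thus \<open>X\<^sub>i\<close> is represented by \<open>axis i 1\<close>, the same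
  vector represents \<open>E\<close>, \<open>E(0)\<close> and \<open>exp E\<close>, and \<open>exp\<close> is the identity of \<^typ>\<open>real ^ 'n\<close>.

  The stratification is recorded by the degree \<open>deg i\<close> of the layer to which \<open>X\<^sub>i\<close> belongs. The
  index type is not ordered, so the numbering of the basis by layers is replaced by \<open>deg\<close>; the
  indices \<open>1, \<dots>, r\<close> of the horizontal layer are the \<open>i\<close> with \<open>deg i = 1\<close>.
\<close>

primrec Ck :: "nat \<Rightarrow> ('a::real_normed_vector \<Rightarrow> 'b::real_normed_vector) \<Rightarrow> bool" where
  "Ck 0 f \<longleftrightarrow> continuous_on UNIV f"
| "Ck (Suc k) f \<longleftrightarrow>
     (\<forall>x. f differentiable (at x)) \<and> (\<forall>v. Ck k (\<lambda>x. frechet_derivative f (at x) v))"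

definition smooth :: "('a::real_normed_vector \<Rightarrow> 'b::real_normed_vector) \<Rightarrow> bool" where
  "smooth f \<longleftrightarrow> (\<forall>k. Ck k f)"

text \<open>The left-invariant vector field whose value at the identity is \<open>v\<close>.\<close>

definition left_field ::
  "(real^'n \<Rightarrow> real^'n \<Rightarrow> real^'n) \<Rightarrow> real^'n \<Rightarrow> real^'n \<Rightarrow> real^'n" where
  "left_field m v x = frechet_derivative (m x) (at 0) v"

definition field_bracket ::
  "(real^'n \<Rightarrow> real^'n) \<Rightarrow> (real^'n \<Rightarrow> real^'n) \<Rightarrow> real^'n \<Rightarrow> real^'n" where
  "field_bracket X Y x =
     frechet_derivative Y (at x) (X x) - frechet_derivative X (at x) (Y x)"

definition lie_bracket ::
  "(real^'n \<Rightarrow> real^'n \<Rightarrow> real^'n) \<Rightarrow> real^'n \<Rightarrow> real^'n \<Rightarrow> real^'n" where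
  "lie_bracket m v w = field_bracket (left_field m v) (left_field m w) 0"

definition layer :: "('n \<Rightarrow> nat) \<Rightarrow> nat \<Rightarrow> (real^'n) set" where
  "layer deg k = span {axis i 1 | i. deg i = k}"

text \<open>
  The third conjunct says that \<open>t \<mapsto> t v\<close> is the one-parameter subgroup with velocity \<open>v\<close>, i.e.
  that the coordinates are exponential ones. It forces the inverse of \<open>x\<close> to be \<open>- x\<close>, which is
  therefore used as the inverse (and is smooth). The layers are in direct sum and span the Lie
  algebra because each \<open>i\<close> has exactly one degree, lying in \<open>{1..s}\<close>.
\<close>

definition carnot_group ::
  "(real^'n \<Rightarrow> real^'n \<Rightarrow> real^'n) \<Rightarrow> ('n \<Rightarrow> nat) \<Rightarrow> nat \<Rightarrow> bool" where
  "carnot_group m deg s \<longleftrightarrow>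
     group m 0 uminus \<and>
     smooth (\<lambda>(x, y). m x y) \<and>
     (\<forall>v a b. m (a *\<^sub>R v) (b *\<^sub>R v) = (a + b) *\<^sub>R v) \<and>
     (\<forall>i. deg i \<in> {1..s}) \<and>
     (\<forall>k\<in>{2..s}. layer deg k =
        span {lie_bracket m v w | v w. v \<in> layer deg 1 \<and> w \<in> layer deg (k - 1)}) \<and>
     (\<forall>v\<in>layer deg 1. \<forall>w\<in>layer deg s. lie_bracket m v w = 0)"

text \<open>
  The projection to the horizontal coordinates; its values are regarded as elements of
  \<^typ>\<open>real ^ 'n\<close> that vanish in the remaining coordinates.
\<close>

definition hproj :: "('n \<Rightarrow> nat) \<Rightarrow> real^'n \<Rightarrow> real^'n" where
  "hproj deg x = (\<chi> i. if deg i = 1 then x $ i else 0)"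

text \<open>The norm on the horizontal layer for which the horizontal \<open>X\<^sub>i\<close> are orthonormal.\<close>

definition omega :: "('n \<Rightarrow> nat) \<Rightarrow> real^'n \<Rightarrow> real" where
  "omega deg v = sqrt (\<Sum>i | deg i = 1. (v $ i)\<^sup>2)"

definition dilation :: "('n \<Rightarrow> nat) \<Rightarrow> real \<Rightarrow> real^'n \<Rightarrow> real^'n" where
  "dilation deg c x = (\<chi> i. c ^ deg i * x $ i)"

section \<open>Horizontal curves and the Carnot-Caratheodory distance\<close>

definition abs_cont_on :: "real \<Rightarrow> real \<Rightarrow> (real \<Rightarrow> 'a::real_normed_vector) \<Rightarrow> bool" where
  "abs_cont_on a b \<gamma> \<longleftrightarrow>
     (\<forall>\<epsilon>>0. \<exists>\<delta>>0. \<forall>D. D division_of \<Union>D \<and> \<Union>D \<subseteq> {a..b} \<and> (\<Sum>k\<in>D. Sup k - Inf k) < \<delta> \<longrightarrow>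
        (\<Sum>k\<in>D. norm (\<gamma> (Sup k) - \<gamma> (Inf k))) < \<epsilon>)"

text \<open>\<open>u j\<close> is the coefficient of \<open>X\<^sub>j\<close> in the velocity; it only matters for \<open>deg j = 1\<close>.\<close>

definition horizontal_with ::
  "(real^'n \<Rightarrow> real^'n \<Rightarrow> real^'n) \<Rightarrow> ('n \<Rightarrow> nat) \<Rightarrow> real \<Rightarrow> real
     \<Rightarrow> (real \<Rightarrow> real^'n) \<Rightarrow> ('n \<Rightarrow> real \<Rightarrow> real) \<Rightarrow> bool" where
  "horizontal_with m deg a b \<gamma> u \<longleftrightarrow>
     abs_cont_on a b \<gamma> \<and>
     (\<forall>j. deg j = 1 \<longrightarrow> u j absolutely_integrable_on {a..b}) \<and>
     (AE t in lebesgue_on {a..b}.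
        (\<gamma> has_vector_derivative (\<Sum>j | deg j = 1. u j t *\<^sub>R left_field m (axis j 1) (\<gamma> t)))
          (at t within {a..b}))"

definition curve_length :: "('n::finite \<Rightarrow> nat) \<Rightarrow> real \<Rightarrow> real \<Rightarrow> ('n \<Rightarrow> real \<Rightarrow> real) \<Rightarrow> real" where
  "curve_length deg a b u = integral {a..b} (\<lambda>t. sqrt (\<Sum>j | deg j = 1. (u j t)\<^sup>2))"

text \<open>
  In a Carnot group any two points are joined by a horizontal curve (Chow's theorem), so the
  infimum is taken over a nonempty set of nonnegative reals.
\<close>

definition cc_dist ::
  "(real^'n \<Rightarrow> real^'n \<Rightarrow> real^'n) \<Rightarrow> ('n \<Rightarrow> nat) \<Rightarrow> real^'n \<Rightarrow> real^'n \<Rightarrow> real" where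
  "cc_dist m deg x y =
     Inf {curve_length deg a b u | a b \<gamma> u.
            a \<le> b \<and> horizontal_with m deg a b \<gamma> u \<and> \<gamma> a = x \<and> \<gamma> b = y}"

text \<open>Horizontal curves with domain the whole real line.\<close>

definition horizontal_on_line ::
  "(real^'n \<Rightarrow> real^'n \<Rightarrow> real^'n) \<Rightarrow> ('n \<Rightarrow> nat) \<Rightarrow> (real \<Rightarrow> real^'n) \<Rightarrow> bool" where
  "horizontal_on_line m deg g \<longleftrightarrow> (\<forall>a b. a \<le> b \<longrightarrow> (\<exists>u. horizontal_with m deg a b g u))"

definition cc_lipschitz_bounds ::
  "(real^'n \<Rightarrow> real^'n \<Rightarrow> real^'n) \<Rightarrow> ('n \<Rightarrow> nat) \<Rightarrow> (real \<Rightarrow> real^'n) \<Rightarrow> real set" where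
  "cc_lipschitz_bounds m deg g =
     {C. 0 \<le> C \<and> (\<forall>s t. cc_dist m deg (g s) (g t) \<le> C * \<bar>s - t\<bar>)}"

definition cc_lipschitz ::
  "(real^'n \<Rightarrow> real^'n \<Rightarrow> real^'n) \<Rightarrow> ('n \<Rightarrow> nat) \<Rightarrow> (real \<Rightarrow> real^'n) \<Rightarrow> bool" where
  "cc_lipschitz m deg g \<longleftrightarrow> cc_lipschitz_bounds m deg g \<noteq> {}"

definition cc_Lip ::
  "(real^'n \<Rightarrow> real^'n \<Rightarrow> real^'n) \<Rightarrow> ('n \<Rightarrow> nat) \<Rightarrow> (real \<Rightarrow> real^'n) \<Rightarrow> real" where
  "cc_Lip m deg g = Inf (cc_lipschitz_bounds m deg g)"

text \<open>The horizontal line \<open>t \<mapsto> q exp(t V)\<close> is \<open>\<lambda>t. m q (t *\<^sub>R V)\<close>.\<close>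

definition joins_horizontal_lines ::
  "(real^'n \<Rightarrow> real^'n \<Rightarrow> real^'n) \<Rightarrow> ('n \<Rightarrow> nat) \<Rightarrow> nat \<Rightarrow> (real \<Rightarrow> real^'n) \<Rightarrow> bool" where
  "joins_horizontal_lines m deg N g \<longleftrightarrow>
     (\<exists>P. partition_on UNIV P \<and> finite P \<and> card P \<le> N \<and>
        (\<forall>I\<in>P. is_interval I \<and>
           (\<exists>q V. V \<in> layer deg 1 \<and> (\<forall>t\<in>I. g t = m q (t *\<^sub>R V)))))"

section \<open>Pansu differentiability and deformability\<close>

definition G_linear ::
  "(real^'n \<Rightarrow> real^'n \<Rightarrow> real^'n) \<Rightarrow> ('n \<Rightarrow> nat) \<Rightarrow> (real^'n \<Rightarrow> real) \<Rightarrow> bool" where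
  "G_linear m deg L \<longleftrightarrow>
     (\<forall>x y. L (m x y) = L x + L y) \<and> (\<forall>c>0. \<forall>x. L (dilation deg c x) = c * L x)"

definition pansu_differentiable ::
  "(real^'n \<Rightarrow> real^'n \<Rightarrow> real^'n) \<Rightarrow> ('n \<Rightarrow> nat) \<Rightarrow> (real^'n \<Rightarrow> real) \<Rightarrow> real^'n \<Rightarrow> bool" where
  "pansu_differentiable m deg f x \<longleftrightarrow>
     (\<exists>L. G_linear m deg L \<and>
        ((\<lambda>y. \<bar>f y - f x - L (m (- x) y)\<bar> / cc_dist m deg x y) \<longlongrightarrow> 0) (at x))"

definition deformable ::
  "(real^'n \<Rightarrow> real^'n \<Rightarrow> real^'n) \<Rightarrow> ('n \<Rightarrow> nat) \<Rightarrow> real^'n \<Rightarrow> bool" where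
  "deformable m deg E \<longleftrightarrow>
     (\<exists>(C::real) (N::nat) (\<Delta>\<^sub>E :: real \<Rightarrow> real).
        C > 0 \<and> N > 0 \<and> (\<forall>\<eta>>0. \<Delta>\<^sub>E \<eta> > 0) \<and>
        (\<forall>l \<eta> \<Delta> u.
           0 < l \<and> l < 1 \<and> 0 < \<eta> \<and> 0 < \<Delta> \<and> \<Delta> < \<Delta>\<^sub>E \<eta> \<and> cc_dist m deg u 0 \<le> 1 \<longrightarrow>
           (\<exists>g. cc_lipschitz m deg g \<and> horizontal_on_line m deg g \<and>
              joins_horizontal_lines m deg N g \<and>
              (\<forall>t. \<bar>t\<bar> \<ge> l \<longrightarrow> g t = t *\<^sub>R E) \<and>
              g (dilation deg (\<Delta> * l) u \<bullet> E) = dilation deg (\<Delta> * l) u \<and>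
              cc_Lip m deg g \<le> 1 + \<eta> * \<Delta> \<and>
              finite {t. \<not> (\<exists>v. ((\<lambda>\<tau>. hproj deg (g \<tau>)) has_vector_derivative v) (at t) \<and>
                              norm (v - hproj deg E) \<le> C * \<Delta>)})))"

end

theory Submission
  imports Defs
begin

text \<open>
  Write \<open>d(x)\<close> for the distance from \<open>x\<close> to the identity and \<open>p\<close> for the horizontal projection. The
  derivative of \<open>d\<close> at \<open>E\<close> is \<open>L(x) = \<langle>p(x), E\<rangle>\<close>. One inequality holds everywhere: \<open>p\<close> is a homomorphism
  that does not increase lengths, so \<open>d(E q) \<ge> |E + p(q)| \<ge> 1 + L(q)\<close>, with equality at \<open>q = 0\<close>. For
  the other, \<open>d(E q) = d(q, E\<^sup>-\<^sup>1)\<close> by left-invariance. The point \<open>q\<close> is \<open>\<delta>\<^sub>D(u)\<close> with \<open>D = d(q)\<close> and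
  \<open>d(u) \<le> 1\<close>, so the line \<open>t \<mapsto> exp(t E)\<close> can be deformed within \<open>|t| < 1/2\<close> to pass through \<open>q\<close> at the
  time \<open>L(q)\<close>, keeping its value \<open>E\<^sup>-\<^sup>1\<close> at the time \<open>-1\<close> and a Lipschitz constant at most \<open>1 + 2 \<eta> D\<close>.
  Hence \<open>d(E q) \<le> (1 + 2 \<eta> D) (1 + L(q))\<close>, which exceeds \<open>1 + L(q)\<close> by at most \<open>4 \<eta> D\<close> for small \<open>q\<close>,
  and \<open>\<eta>\<close> is arbitrary.

  The argument uses basic facts about Carnot groups. The dilations are automorphisms
  (\<open>dil_m\<close>): they respect the bracket, by the Jacobi identity and the stratification, and a linear map
  that respects the bracket respects the group law in exponential coordinates
  (\<open>ad_morphism_imp_hom\<close>). It follows that \<open>p\<close> is a homomorphism (\<open>hproj_m\<close>) and that \<open>d\<close> is homogeneous.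
  The bound \<open>d(x) \<ge> |p(x)|\<close> is the fundamental theorem of calculus for absolutely continuous curves
  (\<open>fundamental_theorem_of_calculus_abs_cont\<close>). Finally, \<open>D\<close> tends to \<open>0\<close> with \<open>q\<close> in the Euclidean
  topology by a quantitative form of Chow's theorem (\<open>reachable_small\<close>).
\<close>


section \<open>Absolutely continuous curves\<close>

lemma AE_lebesgue_on_iff_negligible:
  fixes S :: "'a::euclidean_space set"
  assumes "S \<in> sets lebesgue"
  shows "(AE t in lebesgue_on S. P t) \<longleftrightarrow> negligible {t \<in> S. \<not> P t}"
proof
  assume "AE t in lebesgue_on S. P t"
  then have "AE t in lebesgue. t \<in> S \<longrightarrow> P t"
    using assms by (simp add: AE_restrict_space_iff)
  then obtain N where "N \<in> null_sets lebesgue" "{t \<in> space lebesgue. \<not> (t \<in> S \<longrightarrow> P t)} \<subseteq> N"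
    unfolding eventually_ae_filter by blast
  then show "negligible {t \<in> S. \<not> P t}"
    using negligible_iff_null_sets by (auto intro: negligible_subset)
next
  assume "negligible {t \<in> S. \<not> P t}"
  then have "AE t in lebesgue. t \<in> S \<longrightarrow> P t"
    unfolding eventually_ae_filter negligible_iff_null_sets by (intro bexI) auto
  then show "AE t in lebesgue_on S. P t"
    using assms by (simp add: AE_restrict_space_iff)
qed

lemma negligible_uminus:
  fixes S :: "real set"
  assumes "negligible S"
  shows "negligible {x. - x \<in> S}"
  unfolding negligible_def
proof (intro allI)
  fix a b :: real
  have "(indicat_real S has_integral 0) (cbox (- b) (- a))"
    using assms unfolding negligible_def by blast
  then have "((\<lambda>x. indicat_real S (- x)) has_integral 0) (cbox a b)"
    using has_integral_reflect[of "indicat_real S" 0 "- a" "- b"] by simp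
  moreover have "(\<lambda>x. indicat_real S (- x)) = indicat_real {x. - x \<in> S}"
    by (auto simp: indicator_def)
  ultimately show "(indicat_real {x. - x \<in> S} has_integral 0) (cbox a b)" by simp
qed

lemma division_member:
  fixes D :: "real set set"
  assumes "D division_of \<Union>D" "\<Union>D \<subseteq> {a..b}" "k \<in> D"
  obtains u v where "k = {u..v}" "u \<le> v" "Inf k = u" "Sup k = v" "u \<in> {a..b}" "v \<in> {a..b}"
proof -
  obtain u v where k: "k = cbox u v" "k \<noteq> {}"
    using division_ofD(3,4)[OF assms(1,3)] by auto
  then have "u \<le> v" by auto
  moreover have "k \<subseteq> {a..b}" using assms by blast
  ultimately show ?thesis using that k by auto
qed

lemma abs_cont_onE:
  assumes "abs_cont_on a b \<gamma>" "\<epsilon> > 0"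
  obtains \<delta> where "\<delta> > 0"
    "\<And>D. \<lbrakk>D division_of \<Union>D; \<Union>D \<subseteq> {a..b}; (\<Sum>k\<in>D. Sup k - Inf k) < \<delta>\<rbrakk>
       \<Longrightarrow> (\<Sum>k\<in>D. norm (\<gamma> (Sup k) - \<gamma> (Inf k))) < \<epsilon>"
  using assms unfolding abs_cont_on_def by meson

lemma abs_cont_on_imp_continuous:
  assumes "abs_cont_on a b \<gamma>"
  shows "continuous_on {a..b} \<gamma>"
  unfolding continuous_on_iff
proof (intro ballI allI impI)
  fix x \<epsilon> :: real assume x: "x \<in> {a..b}" and "\<epsilon> > 0"
  obtain \<delta> where "\<delta> > 0" and \<delta>: "\<And>D. \<lbrakk>D division_of \<Union>D; \<Union>D \<subseteq> {a..b}; (\<Sum>k\<in>D. Sup k - Inf k) < \<delta>\<rbrakk>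
       \<Longrightarrow> (\<Sum>k\<in>D. norm (\<gamma> (Sup k) - \<gamma> (Inf k))) < \<epsilon>"
    using abs_cont_onE[OF assms \<open>\<epsilon> > 0\<close>] by blast
  have *: "norm (\<gamma> v - \<gamma> u) < \<epsilon>" if "u \<in> {a..b}" "v \<in> {a..b}" "u \<le> v" "v - u < \<delta>" for u v
  proof -
    have "{cbox u v} division_of cbox u v" using that by (intro division_of_self) auto
    then have "{{u..v}} division_of \<Union>{{u..v}}" by simp
    from \<delta>[OF this] that show ?thesis by simp
  qed
  show "\<exists>d>0. \<forall>y\<in>{a..b}. dist y x < d \<longrightarrow> dist (\<gamma> y) (\<gamma> x) < \<epsilon>"
  proof (intro exI[of _ \<delta>] conjI ballI impI)
    fix y assume y: "y \<in> {a..b}" "dist y x < \<delta>"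
    show "dist (\<gamma> y) (\<gamma> x) < \<epsilon>"
    proof (cases "x \<le> y")
      case True
      then show ?thesis using *[of x y] x y by (simp add: dist_norm)
    next
      case False
      then show ?thesis using *[of y x] x y by (simp add: dist_norm norm_minus_commute)
    qed
  qed (rule \<open>\<delta> > 0\<close>)
qed

lemma abs_cont_on_lipschitz_compose:
  assumes "abs_cont_on a b \<gamma>" "L-lipschitz_on (\<gamma> ` {a..b}) f"
  shows "abs_cont_on a b (\<lambda>t. f (\<gamma> t))"
  unfolding abs_cont_on_def
proof (intro allI impI)
  fix \<epsilon> :: real assume "\<epsilon> > 0"
  have "L \<ge> 0" using assms(2) lipschitz_on_nonneg by blast
  then have "\<epsilon> / (L + 1) > 0" using \<open>\<epsilon> > 0\<close> by simp
  from abs_cont_onE[OF assms(1) this] obtain \<delta> where "\<delta> > 0" and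
    \<delta>: "\<And>D. \<lbrakk>D division_of \<Union>D; \<Union>D \<subseteq> {a..b}; (\<Sum>k\<in>D. Sup k - Inf k) < \<delta>\<rbrakk>
       \<Longrightarrow> (\<Sum>k\<in>D. norm (\<gamma> (Sup k) - \<gamma> (Inf k))) < \<epsilon> / (L + 1)"
    by blast
  show "\<exists>\<delta>>0. \<forall>D. D division_of \<Union>D \<and> \<Union>D \<subseteq> {a..b} \<and> (\<Sum>k\<in>D. Sup k - Inf k) < \<delta> \<longrightarrow>
        (\<Sum>k\<in>D. norm (f (\<gamma> (Sup k)) - f (\<gamma> (Inf k)))) < \<epsilon>"
  proof (intro exI[of _ \<delta>] conjI allI impI, rule \<open>\<delta> > 0\<close>)
    fix D assume D: "D division_of \<Union>D \<and> \<Union>D \<subseteq> {a..b} \<and> (\<Sum>k\<in>D. Sup k - Inf k) < \<delta>"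
    have "(\<Sum>k\<in>D. norm (f (\<gamma> (Sup k)) - f (\<gamma> (Inf k)))) \<le> (\<Sum>k\<in>D. L * norm (\<gamma> (Sup k) - \<gamma> (Inf k)))"
    proof (rule sum_mono)
      fix k assume "k \<in> D"
      with D have "Sup k \<in> {a..b}" "Inf k \<in> {a..b}"
        by (metis division_member)+
      then show "norm (f (\<gamma> (Sup k)) - f (\<gamma> (Inf k))) \<le> L * norm (\<gamma> (Sup k) - \<gamma> (Inf k))"
        using lipschitz_onD[OF assms(2)] by (simp add: dist_norm)
    qed
    also have "\<dots> = L * (\<Sum>k\<in>D. norm (\<gamma> (Sup k) - \<gamma> (Inf k)))" by (simp add: sum_distrib_left)
    also have "\<dots> \<le> L * (\<epsilon> / (L + 1))" using \<delta>[of D] D \<open>L \<ge> 0\<close> by (intro mult_left_mono) auto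
    also have "\<dots> < \<epsilon>" using \<open>L \<ge> 0\<close> \<open>\<epsilon> > 0\<close> by (simp add: field_simps)
    finally show "(\<Sum>k\<in>D. norm (f (\<gamma> (Sup k)) - f (\<gamma> (Inf k)))) < \<epsilon>" .
  qed
qed

lemma lipschitz_imp_abs_cont_on:
  fixes \<gamma> :: "real \<Rightarrow> 'a::real_normed_vector"
  assumes "L-lipschitz_on {a..b} \<gamma>"
  shows "abs_cont_on a b \<gamma>"
proof -
  have "abs_cont_on a b (\<lambda>t. t)"
    unfolding abs_cont_on_def
  proof (intro allI impI)
    fix \<epsilon> :: real assume "\<epsilon> > 0"
    then show "\<exists>\<delta>>0. \<forall>D. D division_of \<Union>D \<and> \<Union>D \<subseteq> {a..b} \<and> (\<Sum>k\<in>D. Sup k - Inf k) < \<delta> \<longrightarrow>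
        (\<Sum>k\<in>D. norm (Sup k - Inf k)) < \<epsilon>"
    proof (intro exI[of _ \<epsilon>] conjI allI impI)
      fix D assume D: "D division_of \<Union>D \<and> \<Union>D \<subseteq> {a..b} \<and> (\<Sum>k\<in>D. Sup k - Inf k) < \<epsilon>"
      have "Sup k - Inf k \<ge> 0" if "k \<in> D" for k
        by (rule division_member[of D a b k]) (use D that in auto)
      then have "(\<Sum>k\<in>D. norm (Sup k - Inf k)) = (\<Sum>k\<in>D. Sup k - Inf k)"
        by (intro sum.cong) auto
      then show "(\<Sum>k\<in>D. norm (Sup k - Inf k)) < \<epsilon>" using D by simp
    qed
  qed
  from abs_cont_on_lipschitz_compose[OF this, of L \<gamma>] assms show ?thesis by simp
qed

lemma abs_cont_on_reflect:
  assumes "abs_cont_on a b \<gamma>"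
  shows "abs_cont_on (- b) (- a) (\<lambda>t. \<gamma> (- t))"
  unfolding abs_cont_on_def
proof (intro allI impI)
  fix \<epsilon> :: real assume "\<epsilon> > 0"
  from abs_cont_onE[OF assms this] obtain \<delta> where "\<delta> > 0" and
    \<delta>: "\<And>D. \<lbrakk>D division_of \<Union>D; \<Union>D \<subseteq> {a..b}; (\<Sum>k\<in>D. Sup k - Inf k) < \<delta>\<rbrakk>
       \<Longrightarrow> (\<Sum>k\<in>D. norm (\<gamma> (Sup k) - \<gamma> (Inf k))) < \<epsilon>"
    by blast
  show "\<exists>\<delta>>0. \<forall>D. D division_of \<Union>D \<and> \<Union>D \<subseteq> {-b..-a} \<and> (\<Sum>k\<in>D. Sup k - Inf k) < \<delta> \<longrightarrow>
        (\<Sum>k\<in>D. norm (\<gamma> (- Sup k) - \<gamma> (- Inf k))) < \<epsilon>"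
  proof (intro exI[of _ \<delta>] conjI allI impI, rule \<open>\<delta> > 0\<close>)
    fix D assume D: "D division_of \<Union>D \<and> \<Union>D \<subseteq> {-b..-a} \<and> (\<Sum>k\<in>D. Sup k - Inf k) < \<delta>"
    define r :: "real set \<Rightarrow> real set" where "r k = uminus ` k" for k
    have inj: "inj_on r D"
      by (auto simp: r_def inj_on_def inj_image_eq_iff)
    have k: "Sup (r k) = - Inf k \<and> Inf (r k) = - Sup k \<and> r k \<subseteq> {a..b} \<and> r k \<noteq> {} \<and> (\<exists>u v. r k = cbox u v)"
      if kD: "k \<in> D" for k
    proof -
      obtain u v where uv: "k = {u..v}" "u \<le> v" "Inf k = u" "Sup k = v" "u \<in> {-b..-a}" "v \<in> {-b..-a}"
        by (rule division_member[of D "- b" "- a" k]) (use D kD in auto)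
      have "r k = {-v..-u}" unfolding r_def uv(1) by simp
      then show ?thesis using uv by auto
    qed
    have "r ` D division_of \<Union>(r ` D)"
    proof (rule division_ofI)
      show "finite (r ` D)" using D by blast
      fix K1 assume K1: "K1 \<in> r ` D"
      show "K1 \<subseteq> \<Union>(r ` D)" using K1 by blast
      show "K1 \<noteq> {}" "\<exists>a b. K1 = cbox a b" using K1 k by blast+
      fix K2 assume K2: "K2 \<in> r ` D" "K1 \<noteq> K2"
      obtain k1 k2 where "k1 \<in> D" "k2 \<in> D" "K1 = r k1" "K2 = r k2" "k1 \<noteq> k2" using K1 K2 by blast
      moreover from this have "interior k1 \<inter> interior k2 = {}" using D by blast
      ultimately show "interior K1 \<inter> interior K2 = {}"
        by (auto simp: r_def interior_negations)
    qed simp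
    moreover have "\<Union>(r ` D) \<subseteq> {a..b}" using k by blast
    moreover have "(\<Sum>k\<in>r ` D. Sup k - Inf k) < \<delta>"
      unfolding sum.reindex[OF inj] using D k by simp
    ultimately have "(\<Sum>k\<in>r ` D. norm (\<gamma> (Sup k) - \<gamma> (Inf k))) < \<epsilon>"
      by (rule \<delta>)
    then show "(\<Sum>k\<in>D. norm (\<gamma> (- Sup k) - \<gamma> (- Inf k))) < \<epsilon>"
      unfolding sum.reindex[OF inj] using k by (simp add: norm_minus_commute)
  qed
qed

lemma division_length_le_measure:
  fixes D :: "real set set"
  assumes D: "D division_of \<Union>D" and U: "\<Union>D \<subseteq> U" "U \<in> lmeasurable"
  shows "(\<Sum>k\<in>D. measure lborel k) \<le> measure lebesgue U"
proof -
  have "((\<lambda>x. 1::real) has_integral (\<Sum>k\<in>D. measure lborel k)) (\<Union>D)"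
  proof (rule has_integral_combine_division[OF D])
    fix k assume "k \<in> D"
    then obtain u v where "k = cbox u v" using D by blast
    then show "((\<lambda>x. 1::real) has_integral measure lborel k) k" 
      using has_integral_const[of "1::real" u v] by simp
  qed
  moreover have "((\<lambda>x. 1::real) has_integral measure lebesgue U) U"
  proof -
    have "indicat_real U = (\<lambda>x. if x \<in> U then 1 else 0)" by (auto simp: indicator_def)
    then show ?thesis
      using U(2) by (simp add: lmeasurable_iff_has_integral has_integral_restrict_UNIV)
  qed
  ultimately show ?thesis
    using has_integral_subset_le[OF U(1)] by simp
qed

text \<open>
  The gauge treats the two kinds of tags differently. At a tag outside \<open>N\<close> it enforces the usual
  derivative estimate. At a tag in \<open>N\<close> it forces the subinterval into an open superset of \<open>N\<close> of
  small measure; absolute continuity then bounds the total increment of \<open>f\<close> over these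
  subintervals, whatever \<open>f'\<close> is there.
\<close>

theorem fundamental_theorem_of_calculus_abs_cont:
  fixes f :: "real \<Rightarrow> 'a::banach"
  assumes "a \<le> b" and ac: "abs_cont_on a b f" and neg: "negligible N"
    and vd: "\<And>x. x \<in> {a..b} - N \<Longrightarrow> (f has_vector_derivative f' x) (at x within {a..b})"
  shows "(f' has_integral f b - f a) {a..b}"
proof -
  \<comment> \<open>On \<open>N\<close> the value of \<open>f'\<close> is arbitrary; with value \<open>0\<close> only the increments of \<open>f\<close> remain.\<close>
  define g where "g x = (if x \<in> N then 0 else f' x)" for x
  have "(g has_integral f b - f a) (cbox a b)"
    unfolding has_integral
  proof (intro allI impI)
    fix e :: real assume "e > 0"
    \<comment> \<open>The summand \<open>2\<close> keeps the denominator positive when \<open>a = b\<close>.\<close>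
    define e' where "e' = e / (2 * (b - a) + 2)"
    have e': "e' > 0" "e' * (b - a) < e / 2"
      using \<open>e > 0\<close> \<open>a \<le> b\<close> by (simp_all add: e'_def field_simps add_pos_nonneg)
    from abs_cont_onE[OF ac half_gt_zero[OF \<open>e > 0\<close>]] obtain \<delta> where "\<delta> > 0" and
      \<delta>: "\<And>D. \<lbrakk>D division_of \<Union>D; \<Union>D \<subseteq> {a..b}; (\<Sum>k\<in>D. Sup k - Inf k) < \<delta>\<rbrakk>
       \<Longrightarrow> (\<Sum>k\<in>D. norm (f (Sup k) - f (Inf k))) < e / 2"
      by blast
    obtain U where U: "open U" "N \<subseteq> U" "U \<in> lmeasurable" "measure lebesgue U < \<delta>"
    proof -
      have N: "N \<in> null_sets lebesgue" using neg by (simp only: negligible_iff_null_sets)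
      obtain T where T: "open T" "N \<subseteq> T" "T - N \<in> lmeasurable" "emeasure lebesgue (T - N) < ennreal \<delta>"
        by (rule sets_lebesgue_outer_open[OF null_setsD2[OF N] \<open>\<delta> > 0\<close>])
      have "emeasure lebesgue T = emeasure lebesgue (T - N)"
        using emeasure_Diff_null_set[OF N, of T] T(1) by simp
      then have m: "emeasure lebesgue T < ennreal \<delta>" using T by simp
      then have "T \<in> lmeasurable" using T(1)
        by (intro fmeasurableI) (auto intro: less_trans)
      moreover have "measure lebesgue T < \<delta>"
        using m \<open>\<delta> > 0\<close> \<open>T \<in> lmeasurable\<close>
        by (metis emeasure_eq_measure2 ennreal_less_iff measure_nonneg)
      ultimately show ?thesis using that T by blast
    qed
    have "\<exists>d>0. x \<in> {a..b} - N \<longrightarrow>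
         (\<forall>y\<in>{a..b}. norm (y - x) < d \<longrightarrow> norm (f y - f x - (y - x) *\<^sub>R f' x) \<le> e' * norm (y - x))" for x
    proof (cases "x \<in> {a..b} - N")
      case True
      then show ?thesis
        using vd[OF True] e'(1) unfolding has_vector_derivative_def has_derivative_within_alt by blast
    qed (use zero_less_one in blast)
    then obtain d where d: "\<And>x. 0 < d x"
        "\<And>x y. \<lbrakk>x \<in> {a..b} - N; y \<in> {a..b}; norm (y - x) < d x\<rbrakk>
           \<Longrightarrow> norm (f y - f x - (y - x) *\<^sub>R f' x) \<le> e' * norm (y - x)"
      by metis
    have "\<exists>r>0. x \<in> N \<longrightarrow> ball x r \<subseteq> U" for x
    proof (cases "x \<in> N")
      case True
      then show ?thesis using U(1,2) unfolding open_contains_ball by blast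
    qed (use zero_less_one in blast)
    then obtain r where r: "\<And>x. 0 < r x" "\<And>x. x \<in> N \<Longrightarrow> ball x (r x) \<subseteq> U" by metis
    define \<G> where "\<G> x = ball x (if x \<in> N then r x else d x)" for x
    show "\<exists>\<G>. gauge \<G> \<and> (\<forall>p. p tagged_division_of cbox a b \<and> \<G> fine p \<longrightarrow>
              norm ((\<Sum>(x, k)\<in>p. measure lborel k *\<^sub>R g x) - (f b - f a)) < e)"
    proof (intro exI[of _ \<G>] conjI allI impI)
      show "gauge \<G>" unfolding \<G>_def by (rule gauge_ball_dependent) (simp add: d r)
      fix p assume "p tagged_division_of cbox a b \<and> \<G> fine p"
      then have p: "p tagged_division_of cbox a b" and fine: "\<G> fine p" by auto
      define h where "h = (\<lambda>(x, k). measure lborel k *\<^sub>R g x - (f (Sup k) - f (Inf k)))"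
      define q where "q = {xk \<in> p. fst xk \<in> N}"
      have fin: "finite p" "q \<subseteq> p" using p by (auto simp: q_def)
      have "(\<Sum>(x, k)\<in>p. measure lborel k *\<^sub>R g x) - (f b - f a) = (\<Sum>xk\<in>p. h xk)"
        using additive_tagged_division_1[OF \<open>a \<le> b\<close>, of p f] p
        by (simp add: h_def split_def sum_subtractf)
      also have "\<dots> = sum h (p - q) + sum h q"
        by (rule sum.subset_diff[OF fin(2,1)])
      finally have split: "(\<Sum>(x, k)\<in>p. measure lborel k *\<^sub>R g x) - (f b - f a) = sum h (p - q) + sum h q" .
      have pk: "x \<in> k \<and> k \<subseteq> {a..b} \<and> (\<exists>u v. k = {u..v} \<and> u \<le> v) \<and> Inf k \<in> k \<and> Sup k \<in> k \<and> Inf k \<le> Sup k \<and> measure lborel k = Sup k - Inf k"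
        if xk: "(x, k) \<in> p" for x k
      proof -
        obtain u v where k: "k = cbox u v" using tagged_division_ofD(4)[OF p xk] by blast
        have "x \<in> k" "k \<subseteq> cbox a b" using tagged_division_ofD(2,3)[OF p xk] by auto
        moreover from this k have "u \<le> v" by auto
        ultimately show ?thesis using k by auto
      qed
      have "norm (sum h (p - q)) \<le> (\<Sum>(x, k)\<in>p - q. e' * (Sup k - Inf k))"
      proof (rule sum_norm_le)
        fix xk assume "xk \<in> p - q"
        then obtain x k where xk_eq: "xk = (x, k)" and xk: "(x, k) \<in> p" "(x, k) \<notin> q"
          by (cases xk) auto
        define u v where "u = Inf k" and "v = Sup k"
        have k: "x \<in> k" "k \<subseteq> {a..b}" "u \<in> k" "v \<in> k" "measure lborel k = v - u" "x \<notin> N" "u \<le> v" "u \<le> x" "x \<le> v"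
          using pk[OF xk(1)] xk by (auto simp: u_def v_def q_def)
        have "k \<subseteq> ball x (d x)" using fineD[OF fine xk(1)] k(6) by (simp add: \<G>_def)
        then have near: "norm (y - x) < d x" if "y \<in> k" for y
          using that by (auto simp: dist_norm norm_minus_commute)
        have "h (x, k) = (v - u) *\<^sub>R f' x - (f v - f u)"
          using k(5,6) by (simp add: h_def g_def u_def v_def)
        also have "\<dots> = (f u - f x - (u - x) *\<^sub>R f' x) - (f v - f x - (v - x) *\<^sub>R f' x)"
          by (simp add: algebra_simps)
        also have "norm \<dots> \<le> norm (f u - f x - (u - x) *\<^sub>R f' x) + norm (f v - f x - (v - x) *\<^sub>R f' x)"
          by (rule norm_triangle_ineq4)
        also have "\<dots> \<le> e' * norm (u - x) + e' * norm (v - x)"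
          using k by (intro add_mono d(2) near) auto
        also have "\<dots> = e' * (v - u)" using k by (simp add: algebra_simps)
        finally show "norm (h xk) \<le> (case xk of (x, k) \<Rightarrow> e' * (Sup k - Inf k))"
          by (simp add: u_def v_def xk_eq)
      qed
      also have "\<dots> \<le> (\<Sum>(x, k)\<in>p. e' * (Sup k - Inf k))"
        by (rule sum_mono2) (use fin e' pk in \<open>auto simp: mult_nonneg_nonneg\<close>)
      also have "\<dots> = e' * (\<Sum>(x, k)\<in>p. Sup k - Inf k)" by (simp add: sum_distrib_left split_def)
      also have "\<dots> = e' * (b - a)"
        using additive_tagged_division_1[OF \<open>a \<le> b\<close>, of p "\<lambda>x. x"] p by simp
      finally have 1: "norm (sum h (p - q)) < e / 2" using e' by simp
      have qt: "q tagged_partial_division_of cbox a b"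
        using p fin(2) by (meson tagged_division_of_def tagged_partial_division_subset)
      have D: "snd ` q division_of \<Union>(snd ` q)"
        by (rule partial_division_of_tagged_division[OF qt])
      have qU: "\<Union>(snd ` q) \<subseteq> U"
      proof -
        have kU: "k \<subseteq> U" if "(x, k) \<in> q" for x k
          using that fineD[OF fine, of x k] r(2)[of x] by (auto simp: q_def \<G>_def)
        show ?thesis
        proof (rule Union_least)
          fix k assume "k \<in> snd ` q"
          then obtain x where "(x, k) \<in> q" by force
          then show "k \<subseteq> U" by (rule kU)
        qed
      qed
      have "norm (sum h q) \<le> (\<Sum>(x, k)\<in>q. norm (f (Sup k) - f (Inf k)))"
        by (rule sum_norm_le) (auto simp: h_def g_def q_def norm_minus_commute)
      \<comment> \<open>\<open>Sup {}\<close> and \<open>Inf {}\<close> are unspecified, so the empty interval needs a value of its own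
          before the sum can be indexed by the intervals alone.\<close>
      also have "\<dots> = (\<Sum>(x, k)\<in>q. if k = {} then 0 else norm (f (Sup k) - f (Inf k)))"
        using pk fin(2) by (intro sum.cong) fastforce+
      also have "\<dots> = (\<Sum>k\<in>snd ` q. if k = {} then 0 else norm (f (Sup k) - f (Inf k)))"
      proof (rule sum.over_tagged_division_lemma[OF tagged_partial_division_of_Union_self[OF qt]])
        fix u v :: real assume "box u v = {}"
        then have "v \<le> u" by simp
        then show "(if cbox u v = {} then 0 else norm (f (Sup (cbox u v)) - f (Inf (cbox u v)))) = 0"
          by (cases "u = v") auto
      qed
      also have "\<dots> = (\<Sum>k\<in>snd ` q. norm (f (Sup k) - f (Inf k)))"
        using pk fin(2) by (intro sum.cong) fastforce+
      also have "\<dots> < e / 2"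
      proof (rule \<delta>[OF D])
        show "\<Union>(snd ` q) \<subseteq> {a..b}" using pk fin(2) by fastforce
        have "(\<Sum>k\<in>snd ` q. Sup k - Inf k) = (\<Sum>k\<in>snd ` q. measure lborel k)"
          using pk fin(2) by (intro sum.cong) auto
        also have "\<dots> \<le> measure lebesgue U"
          by (rule division_length_le_measure[OF D qU U(3)])
        finally show "(\<Sum>k\<in>snd ` q. Sup k - Inf k) < \<delta>" using U by simp
      qed
      finally have 2: "norm (sum h q) < e / 2" .
      show "norm ((\<Sum>(x, k)\<in>p. measure lborel k *\<^sub>R g x) - (f b - f a)) < e"
        unfolding split using 1 2 norm_triangle_ineq[of "sum h (p - q)" "sum h q"] by linarith
    qed
  qed
  then have "(g has_integral f b - f a) {a..b}" by simp
  then show ?thesis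
    by (rule has_integral_spike[OF neg, rotated]) (simp add: g_def)
qed


section \<open>Lie groups in exponential coordinates\<close>

lemma vd_shift:
  fixes f :: "real \<Rightarrow> 'a::real_normed_vector"
  assumes "((\<lambda>h. f (t + h)) has_vector_derivative D) (at 0)"
  shows "(f has_vector_derivative D) (at t)"
proof -
  have "((\<lambda>s. s - t) has_vector_derivative 1) (at t)"
    by (auto intro!: derivative_eq_intros)
  moreover have "((\<lambda>h. f (t + h)) has_vector_derivative D) (at (t - t))"
    using assms by simp
  ultimately have "((\<lambda>h. f (t + h)) \<circ> (\<lambda>s. s - t) has_vector_derivative 1 *\<^sub>R D) (at t)"
    by (rule vector_diff_chain_at)
  then show ?thesis by (simp add: o_def)
qed

lemma vd_along_line:
  assumes "(f has_derivative f') (at x)"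
  shows "((\<lambda>h. f (x + h *\<^sub>R v)) has_vector_derivative f' v) (at 0)"
proof -
  have "((\<lambda>h. x + h *\<^sub>R v) has_vector_derivative v) (at 0)"
    by (auto intro!: derivative_eq_intros)
  moreover have "(f has_derivative f') (at (x + 0 *\<^sub>R v) within range (\<lambda>h. x + h *\<^sub>R v))"
    using assms by (simp add: has_derivative_at_withinI)
  ultimately have "(f \<circ> (\<lambda>h. x + h *\<^sub>R v) has_vector_derivative f' v) (at 0)"
    by (rule vector_derivative_diff_chain_within)
  then show ?thesis by (simp add: o_def)
qed

lemma linear_vd:
  assumes "linear f" "(g has_vector_derivative g') F"
  shows "((\<lambda>t. f (g t :: real^'n) :: real^'k) has_vector_derivative f g') F"
  using bounded_linear.has_vector_derivative assms linear_conv_bounded_linear by blast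

lemma vd_unique:
  fixes f :: "real \<Rightarrow> 'a::real_normed_vector"
  assumes "(f has_vector_derivative a) (at t)" "(f has_vector_derivative b) (at t)"
  shows "a = b"
  using assms vector_derivative_unique_at by blast

text \<open>
  The third condition says that the lines through the origin are the one-parameter subgroups. It ties
  the linear structure of the coordinates to the group, and is the reason why conjugations are
  linear maps.
\<close>

locale exp_lie_group =
  fixes m :: "real^'n \<Rightarrow> real^'n \<Rightarrow> real^'n"
  assumes grp: "group m 0 uminus"
    and smooth_m: "smooth (\<lambda>(x, y). m x y)"
    and ray: "m (a *\<^sub>R v) (b *\<^sub>R v) = (a + b) *\<^sub>R v"
begin

sublocale G: group m 0 uminus
  by (rule grp)

lemma inv_mult: "- m x y = m (- y) (- x)"
  by (rule G.inverse_distrib_swap)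

lemma group_cancel [simp]: "m (- x) (m x y) = y" "m x (m (- x) y) = y" "m x (- x) = 0" "m (- x) x = 0"
   "m (m y (- x)) x = y" "m (m y x) (- x) = y"
  by (simp_all flip: G.assoc) (simp_all add: G.assoc)

definition Dm :: "real^'n \<Rightarrow> real^'n \<Rightarrow> real^'n \<Rightarrow> real^'n \<Rightarrow> real^'n" where
  "Dm x y a b = frechet_derivative (\<lambda>(x, y). m x y) (at (x, y)) (a, b)"

lemma m_has_derivative:
  "((\<lambda>(x, y). m x y) has_derivative (\<lambda>(a, b). Dm (fst p) (snd p) a b)) (at p)"
proof -
  have "Ck 1 (\<lambda>(x, y). m x y)" using smooth_m by (simp add: smooth_def)
  then show ?thesis
    by (cases p) (simp add: Dm_def frechet_derivative_works case_prod_eta)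
qed

lemma Dm_differentiable: "(\<lambda>p. Dm (fst p) (snd p) a b) differentiable (at p)"
proof -
  have "Ck (Suc (Suc 0)) (\<lambda>(x, y). m x y)" using smooth_m by (simp only: smooth_def)
  then show ?thesis
    unfolding Dm_def by (cases p) simp
qed

lemma Dm_continuous: "continuous_on S (\<lambda>p. Dm (fst p) (snd p) a b)"
  by (intro differentiable_imp_continuous_on differentiable_at_imp_differentiable_on Dm_differentiable)

lemma linear_Dm: "linear (\<lambda>(a, b). Dm x y a b)"
  using m_has_derivative[of "(x, y)"] has_derivative_linear by fastforce

lemma m_vd:
  assumes "(f has_vector_derivative f') (at t within S)" "(g has_vector_derivative g') (at t within S)"
  shows "((\<lambda>t. m (f t) (g t)) has_vector_derivative Dm (f t) (g t) f' g') (at t within S)"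
proof -
  have "((\<lambda>t. (f t, g t)) has_vector_derivative (f', g')) (at t within S)"
    by (rule has_vector_derivative_Pair[OF assms])
  from vector_derivative_diff_chain_within[OF this has_derivative_at_withinI[OF m_has_derivative]]
  show ?thesis by (simp add: o_def)
qed

text \<open>
  The product rule with its arguments separated by equations, so that it can be applied when the
  curves are given by other expressions than the rule would produce.
\<close>

lemma m_vd_eq:
  assumes "(f has_vector_derivative f') (at t within S)" "(g has_vector_derivative g') (at t within S)"
    "f t = x" "g t = y" "h = (\<lambda>t. m (f t) (g t))" "d = Dm x y f' g'"
  shows "(h has_vector_derivative d) (at t within S)"
  using m_vd[OF assms(1,2)] assms by simp

lemma left_mult_has_derivative: "(m x has_derivative Dm x y 0) (at y)"
proof -
  have "((\<lambda>y. (x, y)) has_derivative (\<lambda>b. (0, b))) (at y)"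
    by (auto intro!: derivative_eq_intros)
  from diff_chain_at[OF this m_has_derivative] show ?thesis by (simp add: o_def)
qed

abbreviation X :: "real^'n \<Rightarrow> real^'n \<Rightarrow> real^'n" where
  "X \<equiv> left_field m"

lemma X_eq: "X v x = Dm x 0 0 v"
  unfolding left_field_def frechet_derivative_at[OF left_mult_has_derivative, symmetric] ..

lemma linear_Dm_snd: "linear (Dm x y 0)"
  by (rule has_derivative_linear[OF left_mult_has_derivative])

lemma linear_X: "linear (\<lambda>v. X v x)"
  unfolding X_eq by (rule linear_Dm_snd)

lemma X_at_0 [simp]: "X v 0 = v"
proof -
  have "((\<lambda>h. m 0 (0 + h *\<^sub>R v)) has_vector_derivative X v 0) (at 0)"
    unfolding X_eq by (rule vd_along_line[OF left_mult_has_derivative])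
  moreover have "((\<lambda>h. m 0 (0 + h *\<^sub>R v)) has_vector_derivative v) (at 0)"
    by (auto intro!: derivative_eq_intros)
  ultimately show ?thesis by (rule vd_unique)
qed

lemma X_vd:
  assumes "(k has_vector_derivative v) (at t within S)" "k t = 0"
  shows "((\<lambda>h. m x (k h)) has_vector_derivative X v x) (at t within S)"
  by (rule m_vd_eq[OF has_vector_derivative_const[of x] assms(1)]) (simp_all add: assms(2) X_eq)

lemma line_vd: "((\<lambda>h. h *\<^sub>R v) has_vector_derivative v) (at t within S)"
  by (auto intro!: derivative_eq_intros)

text \<open>
  Left-invariance: both sides are the velocity at \<open>h = 0\<close> of \<open>h \<mapsto> x y exp(h v)\<close>.
\<close>

lemma X_left_translate: "Dm x y 0 (X v y) = X v (m x y)"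
proof (rule vd_unique)
  show "((\<lambda>h. m (m x y) (h *\<^sub>R v)) has_vector_derivative X v (m x y)) (at 0)"
    by (rule X_vd[OF line_vd]) simp
  show "((\<lambda>h. m (m x y) (h *\<^sub>R v)) has_vector_derivative Dm x y 0 (X v y)) (at 0)"
    unfolding G.assoc
    by (rule m_vd_eq[OF has_vector_derivative_const[of x] X_vd[OF line_vd]]) simp_all
qed

lemma X_flow: "((\<lambda>t. m x (t *\<^sub>R v)) has_vector_derivative X v (m x (t *\<^sub>R v))) (at t)"
proof (rule vd_shift)
  show "((\<lambda>h. m x ((t + h) *\<^sub>R v)) has_vector_derivative X v (m x (t *\<^sub>R v))) (at 0)"
    unfolding ray[symmetric] G.assoc[symmetric]
    by (rule X_vd[OF line_vd]) simp
qed

lemma X_on_ray: "X v (t *\<^sub>R v) = v"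
proof (rule vd_unique)
  show "((\<lambda>t. m 0 (t *\<^sub>R v)) has_vector_derivative X v (t *\<^sub>R v)) (at t)"
    using X_flow[of 0 v t] by simp
  show "((\<lambda>t. m 0 (t *\<^sub>R v)) has_vector_derivative v) (at t)"
    by (simp add: line_vd)
qed

text \<open>
  The quotient \<open>f g\<^sup>-\<^sup>1\<close> is constant. Its derivative at \<open>t\<close> depends only on the velocities of \<open>f\<close>
  and \<open>g\<close>, and these are also the velocities of \<open>x exp(h v)\<close> and \<open>y exp(h v)\<close>, whose
  quotient does not depend on \<open>h\<close>.
\<close>

lemma flow_unique:
  assumes "\<And>t. (f has_vector_derivative X (c t) (f t)) (at t)"
    and "\<And>t. (g has_vector_derivative X (c t) (g t)) (at t)"
    and "f 0 = g 0"
  shows "f t = g t"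
proof -
  have zero: "Dm x (- y) (X v x) (- X v y) = 0" for x y v
  proof (rule vd_unique)
    show "((\<lambda>h. m (m x (h *\<^sub>R v)) (- (m y (h *\<^sub>R v)))) has_vector_derivative
        Dm x (- y) (X v x) (- X v y)) (at 0)"
      by (rule m_vd_eq[OF X_vd[OF line_vd] has_vector_derivative_minus[OF X_vd[OF line_vd]]]) simp_all
    have "m (m x (h *\<^sub>R v)) (- (m y (h *\<^sub>R v))) = m x (- y)" for h
      by (simp add: inv_mult G.assoc)
    then show "((\<lambda>h. m (m x (h *\<^sub>R v)) (- (m y (h *\<^sub>R v)))) has_vector_derivative 0) (at 0)"
      by simp
  qed
  have "((\<lambda>t. m (f t) (- g t)) has_vector_derivative 0) (at t within UNIV)" for t
    using m_vd[OF assms(1) has_vector_derivative_minus[OF assms(2)]] zero by simp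
  then obtain c where c: "\<And>t. t \<in> UNIV \<Longrightarrow> m (f t) (- g t) = c"
    by (rule has_vector_derivative_zero_constant[OF convex_UNIV]) simp
  have "m (f t) (- g t) = m (f 0) (- g 0)" using c[of t] c[of 0] by simp
  also have "\<dots> = 0" using assms(3) by simp
  finally have "m (m (f t) (- g t)) (g t) = m 0 (g t)" by simp
  then show ?thesis by simp
qed

section \<open>The adjoint representation\<close>

text \<open>
  Conjugation itself serves as the adjoint representation: in exponential coordinates it is a
  linear map (\<open>linear_Ad\<close>) and therefore equals its derivative at the identity.
\<close>

definition Ad :: "real^'n \<Rightarrow> real^'n \<Rightarrow> real^'n" where
  "Ad x y = m (m x y) (- x)"

lemma Ad_hom: "Ad x (m y z) = m (Ad x y) (Ad x z)"
  unfolding Ad_def by (metis G.assoc group_cancel(1))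

lemma Ad_mult: "Ad (m x y) z = Ad x (Ad y z)"
  unfolding Ad_def by (simp add: inv_mult G.assoc)

lemma Ad_0 [simp]: "Ad 0 y = y" "Ad x 0 = 0"
  by (simp_all add: Ad_def)

lemma Ad_cancel [simp]: "Ad x (Ad (- x) y) = y" "Ad (- x) (Ad x y) = y"
  by (simp_all flip: Ad_mult)

lemma Ad_differentiable: "(\<lambda>(x, y). Ad x y) differentiable (at p)"
proof -
  have m: "(\<lambda>q. m (f q) (g q)) differentiable (at p)"
    if d: "f differentiable (at p)" "g differentiable (at p)"
    for f g :: "(real^'n) \<times> (real^'n) \<Rightarrow> real^'n"
  proof -
    obtain f' g' where "(f has_derivative f') (at p)" "(g has_derivative g') (at p)"
      using d unfolding differentiable_def by blast
    then have "((\<lambda>q. (f q, g q)) has_derivative (\<lambda>h. (f' h, g' h))) (at p)"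
      by (rule has_derivative_Pair)
    from diff_chain_at[OF this m_has_derivative] show ?thesis
      by (auto simp: o_def differentiable_def)
  qed
  have "(fst::(real^'n) \<times> (real^'n) \<Rightarrow> real^'n) differentiable (at p)" "(snd::(real^'n) \<times> (real^'n) \<Rightarrow> real^'n) differentiable (at p)"
    by (auto intro!: bounded_linear_imp_differentiable bounded_linear_fst bounded_linear_snd)
  then show ?thesis
    unfolding Ad_def split_def by (intro m differentiable_minus)
qed

lemma Ad_differentiable_fst: "(\<lambda>x. Ad x y) differentiable (at x)"
proof -
  obtain D where "((\<lambda>(x, y). Ad x y) has_derivative D) (at (x, y))"
    using Ad_differentiable unfolding differentiable_def by blast
  moreover have "((\<lambda>x. (x, y)) has_derivative (\<lambda>a. (a, 0))) (at x)"
    by (auto intro!: derivative_eq_intros)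
  ultimately have "((\<lambda>(x, y). Ad x y) \<circ> (\<lambda>x. (x, y)) has_derivative D \<circ> (\<lambda>a. (a, 0))) (at x)"
    by (intro diff_chain_at)
  then show ?thesis by (auto simp: o_def differentiable_def)
qed

lemma Ad_differentiable_snd: "Ad x differentiable (at y)"
proof -
  obtain D where "((\<lambda>(x, y). Ad x y) has_derivative D) (at (x, y))"
    using Ad_differentiable unfolding differentiable_def by blast
  moreover have "((\<lambda>y. (x, y)) has_derivative (\<lambda>a. (0, a))) (at y)"
    by (auto intro!: derivative_eq_intros)
  ultimately have "((\<lambda>(x, y). Ad x y) \<circ> (\<lambda>y. (x, y)) has_derivative D \<circ> (\<lambda>a. (0, a))) (at y)"
    by (intro diff_chain_at)
  then show ?thesis by (auto simp: o_def differentiable_def)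
qed

text \<open>
  Conjugation maps a line through the origin to a one-parameter subgroup, which is again a line by
  the uniqueness of integral curves. So conjugation agrees with its derivative at the origin.
\<close>

lemma linear_Ad: "linear (Ad x)"
proof -
  obtain D where D: "(Ad x has_derivative D) (at 0)"
    using Ad_differentiable_snd unfolding differentiable_def by blast
  have "D v = Ad x v" for v
  proof -
    have d0: "((\<lambda>h. Ad x (h *\<^sub>R v)) has_vector_derivative D v) (at 0)"
      using vd_along_line[OF D, of v] by simp
    have "Ad x (1 *\<^sub>R v) = 1 *\<^sub>R D v"
    proof (rule flow_unique[where c = "\<lambda>_. D v" and f="\<lambda>t. Ad x (t *\<^sub>R v)" and g="\<lambda>t. t *\<^sub>R D v"])
      fix t :: real
      show "((\<lambda>t. Ad x (t *\<^sub>R v)) has_vector_derivative X (D v) (Ad x (t *\<^sub>R v))) (at t)"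
      proof (rule vd_shift)
        show "((\<lambda>h. Ad x ((t + h) *\<^sub>R v)) has_vector_derivative X (D v) (Ad x (t *\<^sub>R v))) (at 0)"
          unfolding ray[symmetric] Ad_hom by (rule X_vd[OF d0]) simp
      qed
      show "((\<lambda>t. t *\<^sub>R D v) has_vector_derivative X (D v) (t *\<^sub>R D v)) (at t)"
        unfolding X_on_ray by (rule line_vd)
    qed simp
    then show ?thesis by simp
  qed
  then have "D = Ad x" by (rule ext)
  then show ?thesis using has_derivative_linear[OF D] by simp
qed

definition ad :: "real^'n \<Rightarrow> real^'n \<Rightarrow> real^'n" where
  "ad u v = frechet_derivative (\<lambda>x. Ad x v) (at 0) u"

lemma ad_has_derivative: "((\<lambda>x. Ad x v) has_derivative (\<lambda>u. ad u v)) (at 0)"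
  unfolding ad_def using Ad_differentiable_fst[of v 0] by (simp add: frechet_derivative_works)

lemma ad_vd: "((\<lambda>t. Ad (t *\<^sub>R u) v) has_vector_derivative ad u v) (at 0)"
  using vd_along_line[OF ad_has_derivative, of u v] by simp

lemma bilinear_ad: "bilinear ad"
proof -
  have "linear (\<lambda>u. ad u v)" for v
    by (rule has_derivative_linear[OF ad_has_derivative])
  moreover have "linear (ad u)" for u
  proof (rule linearI)
    fix v w c
    have "((\<lambda>t. Ad (t *\<^sub>R u) (v + w)) has_vector_derivative ad u v + ad u w) (at 0)"
      unfolding linear_add[OF linear_Ad] by (intro has_vector_derivative_add ad_vd)
    then show "ad u (v + w) = ad u v + ad u w"
      by (rule vd_unique[OF ad_vd])
    have "((\<lambda>t. Ad (t *\<^sub>R u) (c *\<^sub>R v)) has_vector_derivative c *\<^sub>R ad u v) (at 0)"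
      unfolding linear_cmul[OF linear_Ad]
      by (rule bounded_linear.has_vector_derivative[OF bounded_linear_scaleR_right ad_vd])
    then show "ad u (c *\<^sub>R v) = c *\<^sub>R ad u v"
      by (rule vd_unique[OF ad_vd])
  qed
  ultimately show ?thesis by (simp add: bilinear_def)
qed

text \<open>
  Conjugation by \<open>x\<close> is an automorphism, so it carries the conjugation by \<open>t u\<close> to the
  conjugation by \<open>t Ad x u\<close>; differentiate in \<open>t\<close>.
\<close>

lemma Ad_ad: "Ad x (ad u v) = ad (Ad x u) (Ad x v)"
proof (rule vd_unique)
  have *: "Ad (t *\<^sub>R Ad x u) (Ad x v) = Ad x (Ad (t *\<^sub>R u) v)" for t
  proof -
    have "t *\<^sub>R Ad x u = m (m x (t *\<^sub>R u)) (- x)"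
      by (simp add: linear_cmul[OF linear_Ad] flip: Ad_def)
    then show ?thesis by (simp add: Ad_mult)
  qed
  show "((\<lambda>t. Ad (t *\<^sub>R Ad x u) (Ad x v)) has_vector_derivative Ad x (ad u v)) (at 0)"
    unfolding * by (rule linear_vd[OF linear_Ad ad_vd])
  show "((\<lambda>t. Ad (t *\<^sub>R Ad x u) (Ad x v)) has_vector_derivative ad (Ad x u) (Ad x v)) (at 0)"
    by (rule ad_vd)
qed

text \<open>
  The infinitesimal form of \<open>Ad_ad\<close>: take \<open>x = t w\<close> and differentiate in \<open>t\<close>.
\<close>

lemma jacobi: "ad w (ad u v) = ad (ad w u) v + ad u (ad w v)"
proof (rule vd_unique)
  have bb: "bounded_bilinear ad"
    using bilinear_ad bilinear_conv_bounded_bilinear by blast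
  show "((\<lambda>t. Ad (t *\<^sub>R w) (ad u v)) has_vector_derivative ad w (ad u v)) (at 0)"
    by (rule ad_vd)
  have "((\<lambda>t. ad (Ad (t *\<^sub>R w) u) (Ad (t *\<^sub>R w) v)) has_vector_derivative
      ad (Ad (0 *\<^sub>R w) u) (ad w v) + ad (ad w u) (Ad (0 *\<^sub>R w) v)) (at 0)"
    by (rule bounded_bilinear.has_vector_derivative[OF bb ad_vd ad_vd])
  then show "((\<lambda>t. Ad (t *\<^sub>R w) (ad u v)) has_vector_derivative ad (ad w u) v + ad u (ad w v)) (at 0)"
    by (simp add: Ad_ad add.commute)
qed

lemma X_differentiable: "X v differentiable (at x)"
proof -
  obtain D where "((\<lambda>p. Dm (fst p) (snd p) 0 v) has_derivative D) (at (x, 0))"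
    using Dm_differentiable unfolding differentiable_def by blast
  moreover have "((\<lambda>x. (x, 0)) has_derivative (\<lambda>a. (a, 0))) (at x)"
    by (auto intro!: derivative_eq_intros)
  ultimately have "((\<lambda>p. Dm (fst p) (snd p) 0 v) \<circ> (\<lambda>x. (x, 0)) has_derivative D \<circ> (\<lambda>a. (a, 0))) (at x)"
    by (intro diff_chain_at)
  moreover have "X v = (\<lambda>p. Dm (fst p) (snd p) 0 v) \<circ> (\<lambda>x. (x, 0))"
    by (auto simp: X_eq)
  ultimately show ?thesis by (auto simp: differentiable_def)
qed

text \<open>
  Since \<open>x exp(h v) = exp(h Ad x v) x\<close>, a left-invariant field is a right-invariant one with the
  direction \<open>Ad x v\<close>, and inversion \<open>x \<mapsto> -x\<close> turns the latter into a left-invariant field again.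
\<close>

lemma X_Ad: "X v x = X (Ad x v) (- x)"
proof (rule vd_unique)
  have "m x (h *\<^sub>R v) = - m (- x) (h *\<^sub>R (- Ad x v))" for h
  proof -
    have "m x (h *\<^sub>R v) = m (Ad x (h *\<^sub>R v)) x" by (simp add: Ad_def)
    also have "\<dots> = m (- (h *\<^sub>R (- Ad x v))) x" by (simp add: linear_cmul[OF linear_Ad])
    finally show ?thesis by (simp add: inv_mult)
  qed
  then have "((\<lambda>h. m x (h *\<^sub>R v)) has_vector_derivative - X (- Ad x v) (- x)) (at 0)"
    by (simp only:) (rule has_vector_derivative_minus[OF X_vd[OF line_vd]], simp)
  then show "((\<lambda>h. m x (h *\<^sub>R v)) has_vector_derivative X (Ad x v) (- x)) (at 0)"
    by (simp add: linear_neg[OF linear_X])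
  show "((\<lambda>h. m x (h *\<^sub>R v)) has_vector_derivative X v x) (at 0)"
    by (rule X_vd[OF line_vd]) simp
qed

lemma X_expand: "X v x = (\<Sum>i\<in>UNIV. (v $ i) *\<^sub>R X (axis i 1) x)"
proof -
  have "X (\<Sum>i\<in>UNIV. (v $ i) *\<^sub>R axis i 1) x = (\<Sum>i\<in>UNIV. (v $ i) *\<^sub>R X (axis i 1) x)"
    by (simp add: linear_sum[OF linear_X] linear_cmul[OF linear_X])
  then show ?thesis using basis_expansion[of v] by (simp add: scalar_mult_eq_scaleR)
qed

text \<open>
  Let \<open>B u v\<close> be the derivative of the field \<open>X v\<close> at the origin in the direction \<open>u\<close>. The field
  \<open>X u\<close> is constant along the line of \<open>u\<close>, so \<open>B\<close> is alternating and the bracket is \<open>2 B\<close>.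
  Differentiating \<open>X_Ad\<close> gives \<open>B u v = ad u v - B u v\<close>.
\<close>

lemma lie_bracket_eq_ad: "lie_bracket m u v = ad u v"
proof -
  define B where "B u v = frechet_derivative (X v) (at 0) u" for u v
  have hd: "(X v has_derivative (\<lambda>u. B u v)) (at 0)" for v
    unfolding B_def using X_differentiable frechet_derivative_works by metis
  have Bvd: "((\<lambda>t. X v (t *\<^sub>R u)) has_vector_derivative B u v) (at 0)" for u v
    using vd_along_line[OF hd[of v], of u] by simp
  have diag: "B u u = 0" for u
    using Bvd[of u u] vd_unique[OF _ has_vector_derivative_const] by (simp add: X_on_ray)
  have add1: "B (u + u') v = B u v + B u' v" for u u' v
    by (rule linear_add[OF has_derivative_linear[OF hd]])
  have lin2: "B u v = (\<Sum>i\<in>UNIV. (v $ i) *\<^sub>R B u (axis i 1))" for u v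
  proof (rule vd_unique[OF Bvd])
    show "((\<lambda>t. X v (t *\<^sub>R u)) has_vector_derivative (\<Sum>i\<in>UNIV. (v $ i) *\<^sub>R B u (axis i 1))) (at 0)"
      unfolding X_expand[of v]
      by (intro has_vector_derivative_sum bounded_linear.has_vector_derivative[OF bounded_linear_scaleR_right] Bvd)
  qed
  have add2: "B u (v + v') = B u v + B u v'" for u v v'
    by (simp add: lin2[of u "v + v'"] lin2[of u v] lin2[of u v'] scaleR_left_distrib sum.distrib)
  have anti: "B v u = - B u v" for u v
  proof -
    have "0 = B (u + v) (u + v)" by (simp only: diag)
    also have "\<dots> = B u v + B v u" unfolding add1 add2 by (simp add: diag)
    finally have "B u v + B v u = 0" by simp
    then show ?thesis by (metis add_eq_0_iff)
  qed
  have "B u v = ad u v - B u v"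
  proof (rule vd_unique[OF Bvd])
    have c: "((\<lambda>t. Ad (t *\<^sub>R u) v $ i) has_real_derivative ad u v $ i) (at 0)" for i
      using bounded_linear.has_vector_derivative[OF bounded_linear_vec_nth ad_vd]
      by (simp add: has_real_derivative_iff_has_vector_derivative)
    have e: "((\<lambda>t. X w (t *\<^sub>R (- u))) has_vector_derivative - B u w) (at 0)" for w
      using Bvd[of w "- u"] linear_neg[OF has_derivative_linear[OF hd]] by metis
    have "((\<lambda>t. \<Sum>i\<in>UNIV. (Ad (t *\<^sub>R u) v $ i) *\<^sub>R X (axis i 1) (t *\<^sub>R (- u))) has_vector_derivative
       (\<Sum>i\<in>UNIV. (Ad (0 *\<^sub>R u) v $ i) *\<^sub>R (- B u (axis i 1)) + (ad u v $ i) *\<^sub>R X (axis i 1) (0 *\<^sub>R (- u)))) (at 0)"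
      by (intro has_vector_derivative_sum has_vector_derivative_scaleR c e)
    also have "(\<Sum>i\<in>UNIV. (Ad (0 *\<^sub>R u) v $ i) *\<^sub>R (- B u (axis i 1)) + (ad u v $ i) *\<^sub>R X (axis i 1) (0 *\<^sub>R (- u)))
        = (\<Sum>i\<in>UNIV. (ad u v $ i) *\<^sub>R axis i 1) - B u v"
      by (simp add: sum_subtractf lin2[of u v])
    also have "(\<Sum>i\<in>UNIV. (ad u v $ i) *\<^sub>R axis i 1) = ad u v"
      using basis_expansion[of "ad u v"] by (simp add: scalar_mult_eq_scaleR)
    also have "(\<lambda>t. \<Sum>i\<in>UNIV. (Ad (t *\<^sub>R u) v $ i) *\<^sub>R X (axis i 1) (t *\<^sub>R (- u))) = (\<lambda>t. X v (t *\<^sub>R u))"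
      by (subst X_Ad, subst (2) X_expand) simp
    finally show "((\<lambda>t. X v (t *\<^sub>R u)) has_vector_derivative ad u v - B u v) (at 0)" .
  qed
  then show ?thesis
    by (simp add: lie_bracket_def field_bracket_def anti[of v u] algebra_simps flip: B_def) 
qed

section \<open>Morphisms of Lie algebras are morphisms of groups\<close>

lemma Dm_0: "Dm 0 0 a b = a + b"
proof (rule vd_unique)
  have "((\<lambda>(x, y). m x y) has_derivative (\<lambda>(a, b). Dm 0 0 a b)) (at (0, 0))"
    using m_has_derivative[of "(0, 0)"] by simp
  then have *: "((\<lambda>h. case (0, 0) + h *\<^sub>R (a, b) of (x, y) \<Rightarrow> m x y) has_vector_derivative Dm 0 0 a b) (at 0)" for a b
    using vd_along_line by fastforce
  show "((\<lambda>h. m (h *\<^sub>R a) 0 + m 0 (h *\<^sub>R b)) has_vector_derivative (a + b)) (at 0)"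
    by (auto intro!: derivative_eq_intros)
  have "Dm 0 0 a b = Dm 0 0 a 0 + Dm 0 0 0 b"
    using linear_add[OF linear_Dm[of 0 0], of "(a, 0)" "(0, b)"] by simp
  then show "((\<lambda>h. m (h *\<^sub>R a) 0 + m 0 (h *\<^sub>R b)) has_vector_derivative Dm 0 0 a b) (at 0)"
    using has_vector_derivative_add[OF *[of a 0] *[of 0 b]] by simp
qed

lemma continuous_m:
  assumes "continuous_on S f" "continuous_on S g"
  shows "continuous_on S (\<lambda>s. m (f s) (g s))"
proof -
  have "continuous_on UNIV (\<lambda>(x, y). m x y)"
    using m_has_derivative has_derivative_continuous continuous_at_imp_continuous_on by blast
  then have "continuous_on S (\<lambda>s. (\<lambda>(x, y). m x y) (f s, g s))"
    by (rule continuous_on_compose2) (auto intro!: continuous_intros assms)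
  then show ?thesis by simp
qed

lemma continuous_Ad:
  assumes "continuous_on S f"
  shows "continuous_on S (\<lambda>s. Ad (f s) w)"
  unfolding Ad_def by (intro continuous_m continuous_intros assms)

lemma continuous_X:
  assumes "continuous_on S c" "continuous_on S f"
  shows "continuous_on S (\<lambda>s. X (c s) (f s))"
proof -
  have "continuous_on UNIV (X (axis i 1))" for i
    by (intro differentiable_imp_continuous_on differentiable_at_imp_differentiable_on X_differentiable)
  then have "continuous_on S (\<lambda>s. X (axis i 1) (f s))" for i
    by (rule continuous_on_compose2) (auto intro!: assms)
  then show ?thesis
    unfolding X_expand[of "c _"] by (intro continuous_intros assms)
qed

text \<open>
  The left-invariant Maurer-Cartan form; it inverts the frame \<open>v \<mapsto> X v x\<close>.
\<close>

definition theta :: "real^'n \<Rightarrow> real^'n \<Rightarrow> real^'n" where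
  "theta x w = Dm (- x) x 0 w"

lemma theta_X: "theta x (X v x) = v"
  unfolding theta_def X_left_translate by simp

lemma X_theta: "X (theta x w) x = w"
proof -
  have "(\<lambda>v. X v x) \<circ> theta x = id \<longleftrightarrow> theta x \<circ> (\<lambda>v. X v x) = id"
    by (rule linear_inverse_left) (auto simp: linear_X theta_def[abs_def] linear_Dm_snd)
  then show ?thesis by (metis (no_types) comp_apply eq_id_iff theta_X)
qed

lemma vd_ident_scaleR:
  fixes f :: "real \<Rightarrow> 'a::real_normed_vector"
  assumes "isCont f 0"
  shows "((\<lambda>h. h *\<^sub>R f h) has_vector_derivative f 0) (at 0)"
  unfolding has_vector_derivative_def has_derivative_at
proof (intro conjI bounded_linear_scaleR_left)
  have "((\<lambda>h. norm (f h - f 0)) \<longlongrightarrow> 0) (at 0)"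
    using assms unfolding isCont_def by (simp add: LIM_zero tendsto_norm_zero)
  moreover have "\<forall>\<^sub>F h in at 0. norm (f h - f 0) = norm ((0 + h) *\<^sub>R f (0 + h) - 0 *\<^sub>R f 0 - h *\<^sub>R f 0) / norm h"
    by (auto simp: eventually_at_filter simp flip: scaleR_diff_right)
  ultimately show "((\<lambda>h. norm ((0 + h) *\<^sub>R f (0 + h) - 0 *\<^sub>R f 0 - h *\<^sub>R f 0) / norm h) \<longlongrightarrow> 0) (at 0)"
    by (rule Lim_transform_eventually)
qed

text \<open>
  The formula for the differential of the exponential map. The curve
  \<open>F\<^sub>e(t) = exp(-t x) exp(t (x + e w))\<close> has the velocity \<open>e X(Ad(-t (x + e w)) w)\<close>. Integrate over
  \<open>[0, 1]\<close>, divide by \<open>e\<close> and let \<open>e\<close> tend to \<open>0\<close>, where \<open>F\<^sub>0 = 0\<close>. It shows that the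
  form, and with it the group law, depends on the bracket only.
\<close>

lemma theta_integral: "((\<lambda>t. Ad (- (t *\<^sub>R x)) w) has_integral theta x w) {0..1}"
proof -
  define z where "z e = x + e *\<^sub>R w" for e
  define F where "F e t = m (- (t *\<^sub>R x)) (t *\<^sub>R z e)" for e t
  define K where "K e t = X (Ad (- (t *\<^sub>R z e)) w) (F e t)" for e t
  have vd: "(F e has_vector_derivative e *\<^sub>R K e t) (at t)" for e t
  proof (rule vd_shift)
    have F: "F e (t + h) = m (F e t) (Ad (- (t *\<^sub>R z e)) (m (h *\<^sub>R (- x)) (h *\<^sub>R z e)))" for h
    proof -
      have "- ((t + h) *\<^sub>R x) = m (- (t *\<^sub>R x)) (h *\<^sub>R (- x))"
        using ray[of "- t" x "- h"] by (simp add: algebra_simps)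
      moreover have "(t + h) *\<^sub>R z e = m (h *\<^sub>R z e) (t *\<^sub>R z e)"
        by (simp add: ray add.commute)
      ultimately show ?thesis by (simp add: F_def Ad_def G.assoc)
    qed
    have "((\<lambda>h. m (h *\<^sub>R (- x)) (h *\<^sub>R z e)) has_vector_derivative e *\<^sub>R w) (at 0)"
      by (rule m_vd_eq[OF line_vd[of "- x"] line_vd[of "z e"], where x = 0 and y = 0]) (simp_all add: Dm_0 z_def)
    from linear_vd[OF linear_Ad this]
    have "((\<lambda>h. F e (t + h)) has_vector_derivative X (Ad (- (t *\<^sub>R z e)) (e *\<^sub>R w)) (F e t)) (at 0)"
      unfolding F by (rule X_vd) simp
    then show "((\<lambda>h. F e (t + h)) has_vector_derivative e *\<^sub>R K e t) (at 0)"
      by (simp add: K_def linear_cmul[OF linear_Ad] linear_cmul[OF linear_X])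
  qed
  have "((\<lambda>t. e *\<^sub>R K e t) has_integral (F e 1 - F e 0)) {0..1}" for e
    by (rule fundamental_theorem_of_calculus) (auto intro: has_vector_derivative_at_within vd)
  then have F1: "F e 1 = e *\<^sub>R integral {0..1} (K e)" for e
    by (metis F_def add.inverse_neutral group_cancel(4) diff_zero integral_cmul integral_unique scaleR_zero_left)
  have "continuous_on (UNIV \<times> cbox 0 1) (\<lambda>(e, t). K e t)"
    unfolding K_def F_def z_def split_def by (intro continuous_X continuous_Ad continuous_m continuous_intros)
  from integral_continuous_on_param[OF this]
  have "isCont (\<lambda>e. integral {0..1} (K e)) 0"
    by (simp add: continuous_on_eq_continuous_at)
  from vd_ident_scaleR[OF this]
  have "((\<lambda>e. F e 1) has_vector_derivative integral {0..1} (K 0)) (at 0)"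
    by (simp add: F1)
  moreover have "((\<lambda>e. F e 1) has_vector_derivative theta x w) (at 0)"
    using vd_along_line[OF left_mult_has_derivative[of "- x" x], of w] by (simp add: F_def z_def theta_def)
  ultimately have "integral {0..1} (K 0) = theta x w"
    by (rule vd_unique)
  moreover have "K 0 = (\<lambda>t. Ad (- (t *\<^sub>R x)) w)"
    by (simp add: K_def F_def z_def fun_eq_iff)
  moreover have "(\<lambda>t. Ad (- (t *\<^sub>R x)) w) integrable_on {0..1}"
    by (intro integrable_continuous_interval continuous_Ad continuous_intros)
  ultimately show ?thesis by (metis has_integral_integral)
qed

lemma Ad_expand: "Ad x v = (\<Sum>i\<in>UNIV. (v $ i) *\<^sub>R Ad x (axis i 1))"
proof -
  have "Ad x (\<Sum>i\<in>UNIV. (v $ i) *\<^sub>R axis i 1) = (\<Sum>i\<in>UNIV. (v $ i) *\<^sub>R Ad x (axis i 1))"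
    by (simp add: linear_sum[OF linear_Ad] linear_cmul[OF linear_Ad])
  then show ?thesis using basis_expansion[of v] by (simp add: scalar_mult_eq_scaleR)
qed

lemma ad_expand: "ad x v = (\<Sum>i\<in>UNIV. (v $ i) *\<^sub>R ad x (axis i 1))"
proof -
  have l: "linear (ad x)" using bilinear_ad by (simp add: bilinear_def)
  have "ad x (\<Sum>i\<in>UNIV. (v $ i) *\<^sub>R axis i 1) = (\<Sum>i\<in>UNIV. (v $ i) *\<^sub>R ad x (axis i 1))"
    by (simp add: linear_sum[OF l] linear_cmul[OF l])
  then show ?thesis using basis_expansion[of v] by (simp add: scalar_mult_eq_scaleR)
qed

lemma Ad_product_rule:
  assumes "(g has_vector_derivative g') (at 0)"
  shows "((\<lambda>h. Ad (h *\<^sub>R a) (g h)) has_vector_derivative ad a (g 0) + g') (at 0)"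
proof -
  have c: "((\<lambda>t. g t $ i) has_real_derivative g' $ i) (at 0)" for i
    using bounded_linear.has_vector_derivative[OF bounded_linear_vec_nth assms]
    by (simp add: has_real_derivative_iff_has_vector_derivative)
  have "((\<lambda>t. \<Sum>i\<in>UNIV. (g t $ i) *\<^sub>R Ad (t *\<^sub>R a) (axis i 1)) has_vector_derivative
     (\<Sum>i\<in>UNIV. (g 0 $ i) *\<^sub>R ad a (axis i 1) + (g' $ i) *\<^sub>R Ad (0 *\<^sub>R a) (axis i 1))) (at 0)"
    by (intro has_vector_derivative_sum has_vector_derivative_scaleR c ad_vd)
  moreover have "(\<Sum>i\<in>UNIV. (g 0 $ i) *\<^sub>R ad a (axis i 1) + (g' $ i) *\<^sub>R Ad (0 *\<^sub>R a) (axis i 1))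
    = ad a (g 0) + Ad 0 g'"
    unfolding sum.distrib Ad_expand[of 0 g'] ad_expand[of a "g 0"] by simp
  ultimately show ?thesis
    unfolding Ad_expand[of _ "g _"] by simp
qed

text \<open>
  A linear map that respects the bracket intertwines, one after the other: the adjoint
  representations, because both sides solve the same linear differential equation along a ray; the
  forms \<open>theta\<close>, by the integral formula; the left-invariant fields, which are inverse to \<open>theta\<close>;
  and their integral curves \<open>t \<mapsto> x exp(t y)\<close>, by uniqueness.
\<close>

theorem ad_morphism_imp_hom:
  assumes lin: "linear \<delta>" and ad: "\<And>u v. \<delta> (ad u v) = ad (\<delta> u) (\<delta> v)"
  shows "\<delta> (m x y) = m (\<delta> x) (\<delta> y)"
proof -
  have Ad: "\<delta> (Ad u v) = Ad (\<delta> u) (\<delta> v)" for u v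
  proof -
    \<comment> \<open>Variation of constants: \<open>H\<close> is constant because the two flows cancel.\<close>
    define H where "H t = Ad (t *\<^sub>R (- \<delta> u)) (\<delta> (Ad (t *\<^sub>R u) v))" for t
    have "(H has_vector_derivative 0) (at t within UNIV)" for t
    proof (rule vd_shift)
      define w where "w = Ad (t *\<^sub>R u) v"
      have H: "H (t + h) = Ad (t *\<^sub>R (- \<delta> u)) (Ad (h *\<^sub>R (- \<delta> u)) (\<delta> (Ad (h *\<^sub>R u) w)))" for h
        by (simp only: H_def w_def Ad_mult[symmetric] ray add.commute)
      have "((\<lambda>h. \<delta> (Ad (h *\<^sub>R u) w)) has_vector_derivative \<delta> (ad u w)) (at 0)"
        by (rule linear_vd[OF lin ad_vd])
      from linear_vd[OF linear_Ad Ad_product_rule[OF this]]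
      have "((\<lambda>h. H (t + h)) has_vector_derivative
         Ad (t *\<^sub>R (- \<delta> u)) (ad (- \<delta> u) (\<delta> (Ad (0 *\<^sub>R u) w)) + \<delta> (ad u w))) (at 0)"
        unfolding H .
      then show "((\<lambda>h. H (t + h)) has_vector_derivative 0) (at 0)"
        by (simp add: ad bilinear_lneg[OF bilinear_ad])
    qed
    then obtain c where c: "\<And>t. t \<in> UNIV \<Longrightarrow> H t = c"
      by (rule has_vector_derivative_zero_constant[OF convex_UNIV]) simp
    then have "H 1 = H 0" by simp
    then have "Ad (\<delta> u) (Ad (- \<delta> u) (\<delta> (Ad u v))) = Ad (\<delta> u) (\<delta> v)"
      by (simp add: H_def)
    then show ?thesis by simp
  qed
  have theta: "\<delta> (theta x w) = theta (\<delta> x) (\<delta> w)" for x w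
  proof -
    have "((\<delta> \<circ> (\<lambda>t. Ad (- (t *\<^sub>R x)) w)) has_integral \<delta> (theta x w)) {0..1}"
      using lin theta_integral linear_conv_bounded_linear has_integral_linear by blast
    moreover have "\<delta> \<circ> (\<lambda>t. Ad (- (t *\<^sub>R x)) w) = (\<lambda>t. Ad (- (t *\<^sub>R \<delta> x)) (\<delta> w))"
      by (simp add: o_def Ad linear_neg[OF lin] linear_cmul[OF lin])
    ultimately show ?thesis
      using theta_integral has_integral_unique by metis
  qed
  have X: "\<delta> (X v x) = X (\<delta> v) (\<delta> x)" for v x
    using theta[of x "X v x"] X_theta[of "\<delta> x" "\<delta> (X v x)"] by (simp add: theta_X)
  have "\<delta> (m x (1 *\<^sub>R y)) = m (\<delta> x) (1 *\<^sub>R \<delta> y)"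
  proof (rule flow_unique[where c = "\<lambda>_. \<delta> y" and f="\<lambda>t. \<delta> (m x (t *\<^sub>R y))" and g="\<lambda>t. m (\<delta> x) (t *\<^sub>R \<delta> y)"])
    show "((\<lambda>t. \<delta> (m x (t *\<^sub>R y))) has_vector_derivative X (\<delta> y) (\<delta> (m x (t *\<^sub>R y)))) (at t)" for t
      unfolding X[symmetric] by (rule linear_vd[OF lin X_flow])
  qed (simp_all add: X_flow)
  then show ?thesis by simp
qed

end


context exp_lie_group
begin

lemma hom_left_field:
  assumes lin: "linear \<delta>" and hom: "\<And>x y. \<delta> (m x y) = m (\<delta> x) (\<delta> y)"
  shows "\<delta> (X v x) = X (\<delta> v) (\<delta> x)"
proof (rule vd_unique)
  have "((\<lambda>h. \<delta> (m x (h *\<^sub>R v))) has_vector_derivative \<delta> (X v x)) (at 0)"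
    by (rule linear_vd[OF lin X_vd[OF line_vd]]) simp
  then show "((\<lambda>h. m (\<delta> x) (h *\<^sub>R \<delta> v)) has_vector_derivative \<delta> (X v x)) (at 0)"
    by (simp add: hom linear_cmul[OF lin])
  show "((\<lambda>h. m (\<delta> x) (h *\<^sub>R \<delta> v)) has_vector_derivative X (\<delta> v) (\<delta> x)) (at 0)"
    by (rule X_vd[OF line_vd]) simp
qed

lemma m_derivative_chain:
  assumes "(f has_derivative f') (at x)" "(g has_derivative g') (at x)"
  shows "((\<lambda>x. m (f x) (g x)) has_derivative (\<lambda>h. Dm (f x) (g x) (f' h) (g' h))) (at x)"
  using diff_chain_at[OF has_derivative_Pair[OF assms] m_has_derivative] by (simp add: o_def)

end

lemma subspace_derivative:
  fixes f :: "real \<Rightarrow> real^'n"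
  assumes W: "subspace W" and f: "\<And>t. f t \<in> W" and vd: "(f has_vector_derivative f') (at t)"
  shows "f' \<in> W"
proof -
  have "f' \<bullet> y = 0" if y: "y \<in> W\<^sup>\<bottom>" for y
  proof (rule vd_unique)
    show "((\<lambda>t. f t \<bullet> y) has_vector_derivative f' \<bullet> y) (at t)"
      by (rule bounded_linear.has_vector_derivative[OF bounded_linear_inner_left vd])
    have "f t \<bullet> y = 0" for t
      using y f[of t] by (auto simp: orthogonal_comp_def orthogonal_def inner_commute)
    then show "((\<lambda>t. f t \<bullet> y) has_vector_derivative 0) (at t)" by simp
  qed
  then have "f' \<in> W\<^sup>\<bottom>\<^sup>\<bottom>"
    by (auto simp: orthogonal_comp_def orthogonal_def inner_commute)
  then show ?thesis using orthogonal_comp_self[OF W] by simp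
qed

section \<open>The stratification and its dilations\<close>

lemma mem_layer_iff: "v \<in> layer deg k \<longleftrightarrow> (\<forall>i. deg i \<noteq> k \<longrightarrow> v $ i = 0)"
proof
  assume "v \<in> layer deg k"
  then show "\<forall>i. deg i \<noteq> k \<longrightarrow> v $ i = 0"
    unfolding layer_def
    by (induction rule: span_induct_alt) (auto simp: axis_def split: if_splits)
next
  assume v: "\<forall>i. deg i \<noteq> k \<longrightarrow> v $ i = 0"
  have "(\<Sum>i\<in>UNIV. v $ i *\<^sub>R axis i 1) \<in> layer deg k"
    unfolding layer_def
  proof (rule span_sum)
    fix i
    show "v $ i *\<^sub>R axis i 1 \<in> span {axis i 1 |i. deg i = k}"
      using v by (cases "deg i = k") (auto intro: span_scale span_base simp: span_zero)
  qed
  then show "v \<in> layer deg k"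
    using basis_expansion[of v] by (simp add: scalar_mult_eq_scaleR)
qed

lemma subspace_layer: "subspace (layer deg k)"
  unfolding layer_def by (rule subspace_span)

lemma dilation_layer: "v \<in> layer deg k \<Longrightarrow> dilation deg c v = c ^ k *\<^sub>R v"
  by (auto simp: mem_layer_iff dilation_def vec_eq_iff)

lemma linear_dilation: "linear (dilation deg c)"
  by (rule linearI) (simp_all add: dilation_def vec_eq_iff algebra_simps)

lemma dilation_dilation: "dilation deg a (dilation deg b x) = dilation deg (a * b) x"
  by (simp add: dilation_def vec_eq_iff power_mult_distrib)

lemma dilation_1 [simp]: "dilation deg 1 x = x"
  by (simp add: dilation_def vec_eq_iff)

lemma linear_hproj: "linear (hproj deg)"
  by (rule linearI) (simp_all add: hproj_def vec_eq_iff)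

lemma hproj_layer_1: "v \<in> layer deg 1 \<Longrightarrow> hproj deg v = v"
  by (auto simp: mem_layer_iff hproj_def vec_eq_iff)

lemma norm_layer_1: "v \<in> layer deg 1 \<Longrightarrow> norm v = sqrt (\<Sum>j | deg j = 1. (v $ j)\<^sup>2)"
  unfolding norm_vec_def L2_set_def
  by (intro arg_cong[of _ _ sqrt] sum.mono_neutral_cong_right) (auto simp: mem_layer_iff)

lemma hproj_inner: "E \<in> layer deg 1 \<Longrightarrow> hproj deg x \<bullet> E = x \<bullet> E"
  unfolding inner_vec_def by (intro sum.cong) (auto simp: mem_layer_iff hproj_def)

locale carnot =
  fixes m :: "real^'n \<Rightarrow> real^'n \<Rightarrow> real^'n" and deg :: "'n \<Rightarrow> nat" and s :: nat
  assumes carnot_group: "carnot_group m deg s"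
begin

sublocale exp_lie_group m
  by (rule exp_lie_group.intro) (use carnot_group in \<open>simp_all add: carnot_group_def\<close>)

abbreviation V :: "nat \<Rightarrow> (real^'n) set" where "V \<equiv> layer deg"
abbreviation dil :: "real \<Rightarrow> real^'n \<Rightarrow> real^'n" where "dil \<equiv> dilation deg"

lemma dil_horizontal: "v \<in> V 1 \<Longrightarrow> dil c v = c *\<^sub>R v"
  using dilation_layer[of v deg 1 c] by simp

lemma deg_bounds: "1 \<le> deg i" "deg i \<le> s"
  using carnot_group by (auto simp: carnot_group_def)

lemma layer_step: "1 \<le> k \<Longrightarrow> k < s \<Longrightarrow> V (Suc k) = span {ad v w | v w. v \<in> V 1 \<and> w \<in> V k}"
  using carnot_group unfolding carnot_group_def lie_bracket_eq_ad by simp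

lemma layer_above: "k > s \<Longrightarrow> V k = {0}"
  using deg_bounds(2) by (auto simp: mem_layer_iff vec_eq_iff) (metis leD)

lemma linear_ad: "linear (ad u)" "linear (\<lambda>u. ad u v)"
  using bilinear_ad by (auto simp: bilinear_def)

lemma ad_layer_1:
  assumes "u \<in> V 1" "v \<in> V k" "k \<ge> 1"
  shows "ad u v \<in> V (Suc k)"
proof -
  consider "k < s" | "k = s" | "k > s" by linarith
  then show ?thesis
  proof cases
    case 1
    then show ?thesis using assms layer_step by (auto intro: span_base)
  next
    case 2
    then have "ad u v = 0"
      using carnot_group assms unfolding carnot_group_def lie_bracket_eq_ad by auto
    then show ?thesis using subspace_0[OF subspace_layer] by simp
  next
    case 3
    then have "ad u v = 0"
      using assms layer_above linear_0[OF linear_ad(1)] by auto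
    then show ?thesis using subspace_0[OF subspace_layer] by simp
  qed
qed

text \<open>
  Only brackets with \<open>V 1\<close> are prescribed by the stratification. The Jacobi identity reduces a
  bracket with \<open>[a, b]\<close>, \<open>a \<in> V 1\<close>, to brackets with \<open>a\<close> and with \<open>b\<close>, which has a smaller degree.
\<close>

lemma ad_layer:
  assumes "u \<in> V i" "v \<in> V j" "i \<ge> 1" "j \<ge> 1"
  shows "ad u v \<in> V (i + j)"
  using assms(3,1,2,4)
proof (induction i arbitrary: u v j rule: nat_induct_at_least)
  case base
  then show ?case using ad_layer_1 by simp
next
  case (Suc i)
  show ?case
  proof (cases "i < s")
    case True
    have "u \<in> span {ad v w | v w. v \<in> V 1 \<and> w \<in> V i}"
      using Suc.prems(1) Suc.hyps layer_step True by auto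
    then show ?thesis
    proof (induction rule: span_induct_alt)
      case base
      then show ?case
        using linear_0[OF linear_ad(2)] subspace_0[OF subspace_layer] by simp
    next
      case (step c x y)
      then obtain a b where x: "x = ad a b" "a \<in> V 1" "b \<in> V i" by blast
      have "ad a (ad b v) \<in> V (Suc (i + j))"
        using Suc x by (intro ad_layer_1) auto
      moreover have "ad b (ad a v) \<in> V (i + Suc j)"
        using Suc x by (intro Suc.IH ad_layer_1) auto
      ultimately have "ad x v \<in> V (Suc i + j)"
        using jacobi[of a b v] subspace_diff[OF subspace_layer] x(1)
        by (metis add_Suc add_Suc_right add_diff_cancel_right')
      then show ?case
        using step.IH
        by (simp add: linear_add[OF linear_ad(2)] linear_cmul[OF linear_ad(2)]
            subspace_add[OF subspace_layer] subspace_scale[OF subspace_layer])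
    qed
  next
    case False
    then have "u = 0" using Suc.prems layer_above[of "Suc i"] by auto
    then show ?thesis
      using linear_0[OF linear_ad(2)] subspace_0[OF subspace_layer] by simp
  qed
qed

lemma dil_ad: "dil c (ad u v) = ad (dil c u) (dil c v)"
proof -
  have "(\<lambda>u v. dil c (ad u v)) = (\<lambda>u v. ad (dil c u) (dil c v))"
  proof (rule bilinear_eq_stdbasis)
    show "bilinear (\<lambda>u v. dil c (ad u v))" "bilinear (\<lambda>u v. ad (dil c u) (dil c v))"
      unfolding bilinear_def
      using linear_compose[OF linear_ad(1) linear_dilation] linear_compose[OF linear_ad(2) linear_dilation]
        linear_compose[OF linear_dilation linear_ad(1)] linear_compose[OF linear_dilation linear_ad(2)]
      by (simp_all add: o_def)
    fix a b :: "real^'n" assume "a \<in> Basis" "b \<in> Basis"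
    then obtain i j where ij: "a = axis i 1" "b = axis j 1" by (auto simp: Basis_vec_def)
    have "a \<in> V (deg i)" "b \<in> V (deg j)"
      using ij by (auto simp: layer_def intro: span_base)
    moreover from this have "ad a b \<in> V (deg i + deg j)"
      using deg_bounds by (intro ad_layer)
    ultimately show "dil c (ad a b) = ad (dil c a) (dil c b)"
      by (simp add: dilation_layer linear_cmul[OF linear_ad(1)] linear_cmul[OF linear_ad(2)] power_add mult.commute)
  qed
  then show ?thesis by metis
qed

lemma dil_m: "dil c (m x y) = m (dil c x) (dil c y)"
  by (rule ad_morphism_imp_hom[OF linear_dilation dil_ad])

lemma dil_X: "dil c (X v x) = X (dil c v) (dil c x)"
  by (rule hom_left_field[OF linear_dilation dil_m])

lemma dil_vd_0: "((\<lambda>c. dil c x) has_vector_derivative hproj deg x) (at 0)"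
proof -
  have p: "((\<lambda>c::real. c ^ deg i * x $ i) has_real_derivative (if deg i = 1 then x $ i else 0)) (at 0)" for i
  proof -
    have "((\<lambda>c::real. c ^ deg i * x $ i) has_real_derivative real (deg i) * 0 ^ (deg i - 1) * x $ i) (at 0)"
      by (auto intro!: derivative_eq_intros)
    moreover have "real (deg i) * 0 ^ (deg i - 1) * x $ i = (if deg i = 1 then x $ i else 0)"
      using deg_bounds(1)[of i] by (cases "deg i = 1") auto
    ultimately show ?thesis by simp
  qed
  have "((\<lambda>c. \<Sum>i\<in>UNIV. (c ^ deg i * x $ i) *\<^sub>R axis i (1::real)) has_vector_derivative
      (\<Sum>i\<in>UNIV. (0 ^ deg i * x $ i) *\<^sub>R 0 + (if deg i = 1 then x $ i else 0) *\<^sub>R axis i 1)) (at 0)"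
    by (intro has_vector_derivative_sum has_vector_derivative_scaleR has_vector_derivative_const p)
  moreover have "(\<lambda>c. \<Sum>i\<in>UNIV. (c ^ deg i * x $ i) *\<^sub>R axis i (1::real)) = (\<lambda>c. dil c x)"
    using basis_expansion[of "dil _ x"] by (simp add: scalar_mult_eq_scaleR dilation_def)
  moreover have "(\<Sum>i\<in>UNIV. (0 ^ deg i * x $ i) *\<^sub>R 0 + (if deg i = 1 then x $ i else 0) *\<^sub>R axis i 1) = hproj deg x"
    using basis_expansion[of "hproj deg x"] by (simp add: scalar_mult_eq_scaleR hproj_def)
  ultimately show ?thesis by simp
qed

lemma dil_0 [simp]: "dil 0 x = 0"
proof -
  have "deg i \<noteq> 0" for i using deg_bounds(1)[of i] by linarith
  then show ?thesis by (simp add: dilation_def vec_eq_iff)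
qed

text \<open>
  As \<open>c\<close> tends to \<open>0\<close>, \<open>dil c\<close> is to first order \<open>c\<close> times the horizontal projection, and \<open>m\<close>
  is to first order the addition. Comparing the first-order terms of
  \<open>dil c (m x y) = m (dil c x) (dil c y)\<close> gives the claim.
\<close>

lemma hproj_m: "hproj deg (m x y) = hproj deg x + hproj deg y"
proof (rule vd_unique[OF dil_vd_0])
  show "((\<lambda>c. dil c (m x y)) has_vector_derivative hproj deg x + hproj deg y) (at 0)"
    unfolding dil_m
    by (rule m_vd_eq[OF dil_vd_0[of x] dil_vd_0[of y], where x = 0 and y = 0]) (simp_all add: Dm_0)
qed

lemma hproj_X: "hproj deg (X v x) = hproj deg v"
proof (rule vd_unique)
  show "((\<lambda>h. hproj deg (m x (h *\<^sub>R v))) has_vector_derivative hproj deg (X v x)) (at 0)"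
    by (rule linear_vd[OF linear_hproj X_vd[OF line_vd]]) simp
  show "((\<lambda>h. hproj deg (m x (h *\<^sub>R v))) has_vector_derivative hproj deg v) (at 0)"
    unfolding hproj_m linear_cmul[OF linear_hproj] by (auto intro!: derivative_eq_intros)
qed

section \<open>Chow's theorem\<close>

definition hprod :: "(real^'n) list \<Rightarrow> real^'n" where
  "hprod vs = foldr m vs 0"

lemma hprod_simps [simp]: "hprod [] = 0" "hprod (v # vs) = m v (hprod vs)"
  by (simp_all add: hprod_def)

lemma hprod_append: "hprod (vs @ ws) = m (hprod vs) (hprod ws)"
  by (induction vs) (simp_all add: G.assoc)

lemma hprod_inverse: "hprod (rev (map uminus vs)) = - hprod vs"
  by (induction vs) (simp_all add: hprod_append inv_mult)

text \<open>
  Broken horizontal lines from the origin are enough for Chow's theorem. Encoded as lists of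
  horizontal vectors, they are closed under products, inverses and dilations by operations on lists,
  with the evident effect on the length.
\<close>

definition reachable :: "real \<Rightarrow> real^'n \<Rightarrow> bool" where
  "reachable K x \<longleftrightarrow> (\<exists>vs. set vs \<subseteq> V 1 \<and> hprod vs = x \<and> (\<Sum>v\<leftarrow>vs. norm v) \<le> K)"

lemma reachable_0: "reachable 0 0"
  unfolding reachable_def by (intro exI[of _ "[]"]) simp

lemma reachable_mono: "reachable K x \<Longrightarrow> K \<le> K' \<Longrightarrow> reachable K' x"
  unfolding reachable_def by force

lemma reachable_m:
  assumes "reachable K x" "reachable K' y"
  shows "reachable (K + K') (m x y)"
proof -
  obtain vs ws where "set vs \<subseteq> V 1" "hprod vs = x" "(\<Sum>v\<leftarrow>vs. norm v) \<le> K"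
    "set ws \<subseteq> V 1" "hprod ws = y" "(\<Sum>v\<leftarrow>ws. norm v) \<le> K'"
    using assms unfolding reachable_def by blast
  then show ?thesis
    unfolding reachable_def by (intro exI[of _ "vs @ ws"]) (simp add: hprod_append)
qed

lemma reachable_horizontal: "v \<in> V 1 \<Longrightarrow> reachable (norm v) v"
  unfolding reachable_def by (intro exI[of _ "[v]"]) simp

lemma reachable_inverse:
  assumes "reachable K x"
  shows "reachable K (- x)"
proof -
  obtain vs where vs: "set vs \<subseteq> V 1" "hprod vs = x" "(\<Sum>v\<leftarrow>vs. norm v) \<le> K"
    using assms unfolding reachable_def by blast
  have "(\<Sum>v\<leftarrow>rev (map uminus vs). norm v) = (\<Sum>v\<leftarrow>vs. norm v)"
    by (simp add: o_def flip: rev_map)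
  then show ?thesis
    unfolding reachable_def using vs subspace_neg[OF subspace_layer]
    by (intro exI[of _ "rev (map uminus vs)"]) (auto simp: hprod_inverse)
qed

lemma reachable_dil:
  assumes "reachable K x" "c \<ge> 0"
  shows "reachable (c * K) (dil c x)"
proof -
  obtain vs where vs: "set vs \<subseteq> V 1" "hprod vs = x" "(\<Sum>v\<leftarrow>vs. norm v) \<le> K"
    using assms unfolding reachable_def by blast
  have "dil c (hprod vs) = hprod (map ((*\<^sub>R) c) vs)"
    using vs(1) by (induction vs) (simp_all add: dil_m dil_horizontal linear_0[OF linear_dilation])
  moreover have "(\<Sum>v\<leftarrow>map ((*\<^sub>R) c) vs. norm v) = c * (\<Sum>v\<leftarrow>vs. norm v)"
    using \<open>c \<ge> 0\<close> by (simp add: o_def sum_list_const_mult)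
  moreover have "set (map ((*\<^sub>R) c) vs) \<subseteq> V 1"
    using vs(1) by (auto intro!: subspace_scale[OF subspace_layer])
  ultimately show ?thesis
    unfolding reachable_def using vs(2,3) \<open>c \<ge> 0\<close>
    by (intro exI[of _ "map ((*\<^sub>R) c) vs"]) (simp add: mult_left_mono)
qed

text \<open>
  The span is a closed subspace that is invariant under \<open>Ad u\<close> for horizontal \<open>u\<close>, hence under
  \<open>ad u\<close>. It contains \<open>V 1\<close>, and so, by the stratification, every layer.
\<close>

lemma span_conjugates: "span {Ad h v | h v. (\<exists>K. reachable K h) \<and> v \<in> V 1} = UNIV"
proof -
  define W where "W = span {Ad h v | h v. (\<exists>K. reachable K h) \<and> v \<in> V 1}"
  have W: "subspace W" by (simp add: W_def)
  have Ad_W: "Ad u w \<in> W" if "u \<in> V 1" "w \<in> W" for u w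
    using that(2) unfolding W_def
  proof (induction rule: span_induct_alt)
    case (step c x y)
    then obtain h v K where x: "x = Ad h v" "reachable K h" "v \<in> V 1" by blast
    then have "Ad u x = Ad (m u h) v" by (simp add: Ad_mult)
    moreover have "reachable (norm u + K) (m u h)"
      using x that(1) by (intro reachable_m reachable_horizontal)
    ultimately have "Ad u x \<in> span {Ad h v | h v. (\<exists>K. reachable K h) \<and> v \<in> V 1}"
      using x(3) by (intro span_base) blast
    then show ?case
      using step.IH by (simp add: linear_add[OF linear_Ad] linear_cmul[OF linear_Ad] span_add span_scale)
  qed (simp add: span_zero)
  have ad_W: "ad u w \<in> W" if "u \<in> V 1" "w \<in> W" for u w
    using that by (intro subspace_derivative[OF W _ ad_vd] Ad_W subspace_scale[OF subspace_layer])
  have V1_W: "V 1 \<subseteq> W"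
  proof
    fix v assume "v \<in> V 1"
    then have "Ad 0 v \<in> W" unfolding W_def using reachable_0 by (intro span_base) blast
    then show "v \<in> W" by simp
  qed
  have "V (Suc k) \<subseteq> W" if "Suc k \<le> s" for k
    using that
  proof (induction k)
    case (Suc k)
    then have "V (Suc (Suc k)) = span {ad v w | v w. v \<in> V 1 \<and> w \<in> V (Suc k)}"
      by (intro layer_step) auto
    also have "\<dots> \<subseteq> W" using Suc by (intro span_minimal W) (auto intro: ad_W)
    finally show ?case .
  qed (use V1_W in simp)
  then have V_W: "V (deg i) \<subseteq> W" for i
    using deg_bounds[of i] by (metis Suc_le_D One_nat_def)
  have "v \<in> W" for v
  proof -
    have "(\<Sum>i\<in>UNIV. v $ i *\<^sub>R axis i 1) \<in> W"
    proof (intro subspace_sum[OF W] subspace_scale[OF W])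
      fix i
      have "axis i 1 \<in> V (deg i)" by (auto simp: layer_def intro: span_base)
      then show "axis i 1 \<in> W" using V_W by blast
    qed
    then show ?thesis using basis_expansion[of v] by (simp add: scalar_mult_eq_scaleR)
  qed
  then show ?thesis unfolding W_def by blast
qed

text \<open>
  By \<open>span_conjugates\<close> there is a basis of vectors \<open>w j = Ad (h j) (v j)\<close> with \<open>h j\<close> reachable and
  \<open>v j\<close> horizontal, and then \<open>t w j = (h j) (t v j) (h j)\<^sup>-\<^sup>1\<close> is reachable with a length bounded
  for bounded \<open>t\<close>. The map sending \<open>t\<close> to the product of all \<open>t j w j\<close> is differentiable at the
  origin with an invertible derivative, so it covers a neighbourhood of the origin.
\<close>

lemma reachable_neighbourhood: "\<exists>K. \<exists>r>0. \<forall>x. norm x < r \<longrightarrow> reachable K x"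
proof -
  define S where "S = {Ad h v | h v. (\<exists>K. reachable K h) \<and> v \<in> V 1}"
  obtain B where B: "B \<subseteq> S" "independent B" "S \<subseteq> span B"
    using maximal_independent_subset[of S] by blast
  have spanB: "span B = UNIV"
    using span_conjugates span_minimal[OF B(3) subspace_span] unfolding S_def by blast
  have "card B = CARD('n)"
    using dim_span_eq_card_independent[OF B(2)] by (simp add: spanB)
  moreover have "finite B" by (rule finiteI_independent[OF B(2)])
  ultimately obtain w :: "'n \<Rightarrow> real^'n" where w: "bij_betw w UNIV B"
    using finite_same_card_bij[of "UNIV :: 'n set" B] by auto
  have "\<forall>j. \<exists>h v K. w j = Ad h v \<and> reachable K h \<and> v \<in> V 1"
  proof
    fix j
    have "w j \<in> S" using w B(1) by (auto simp: bij_betw_def)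
    then show "\<exists>h v K. w j = Ad h v \<and> reachable K h \<and> v \<in> V 1" unfolding S_def by blast
  qed
  then obtain h v K where hvK: "\<And>j. w j = Ad (h j) (v j)" "\<And>j. reachable (K j) (h j)" "\<And>j. v j \<in> V 1"
    by metis
  obtain js :: "'n list" where js: "set js = UNIV" "distinct js"
    using finite_distinct_list[of "UNIV :: 'n set"] by auto
  define \<Phi> where "\<Phi> is t = foldr (\<lambda>j acc. m (t $ j *\<^sub>R w j) acc) is 0" for "is" and t :: "real^'n"
  have \<Phi>_simps [simp]: "\<Phi> [] t = 0" "\<Phi> (j # is) t = m (t $ j *\<^sub>R w j) (\<Phi> is t)" for j "is" t
    by (simp_all add: \<Phi>_def)
  have \<Phi>0: "\<Phi> is 0 = 0" for "is" by (induction "is") auto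
  have \<Phi>_cont: "continuous_on UNIV (\<Phi> is)" for "is"
  proof (induction "is")
    case (Cons j "is")
    show ?case unfolding \<Phi>_simps by (intro continuous_m continuous_intros Cons)
  next
    case Nil
    have "\<Phi> [] = (\<lambda>t. 0)" by auto
    then show ?case by simp
  qed
  have \<Phi>_deriv: "(\<Phi> is has_derivative (\<lambda>t. \<Sum>j\<leftarrow>is. t $ j *\<^sub>R w j)) (at 0)" for "is"
  proof (induction "is")
    case (Cons j "is")
    have "((\<lambda>t. t $ j *\<^sub>R w j) has_derivative (\<lambda>t. t $ j *\<^sub>R w j)) (at 0)"
      by (intro bounded_linear_imp_has_derivative bounded_linear_scaleR_const bounded_linear_vec_nth)
    from m_derivative_chain[OF this Cons]
    show ?case by (simp add: \<Phi>0 Dm_0 flip: \<Phi>_simps)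
  next
    case Nil
    have "\<Phi> [] = (\<lambda>t. 0)" by auto
    then show ?case by simp
  qed
  define D where "D t = (\<Sum>j\<in>UNIV. t $ j *\<^sub>R w j)" for t :: "real^'n"
  have D: "(\<lambda>t. \<Sum>j\<leftarrow>js. t $ j *\<^sub>R w j) = D"
    unfolding D_def using js by (simp add: sum_list_distinct_conv_sum_set)
  have linD: "linear D"
    using has_derivative_linear[OF \<Phi>_deriv[of js]] unfolding D .
  have "surj D"
  proof -
    have "B \<subseteq> range D"
    proof
      fix b assume "b \<in> B"
      then obtain j where j: "b = w j" using w by (auto simp: bij_betw_def)
      have "D (axis j 1) = (\<Sum>i\<in>UNIV. if i = j then w j else 0)"
        unfolding D_def by (intro sum.cong) (auto simp: axis_def)
      then have "D (axis j 1) = b" by (simp add: j)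
      then show "b \<in> range D" by blast
    qed
    then have "span B \<subseteq> range D"
      using linear_subspace_image[OF linD subspace_UNIV] by (rule span_minimal)
    then show ?thesis using spanB by blast
  qed
  then obtain D' where D': "linear D'" "D \<circ> D' = id"
    using linear_surjective_right_inverse[OF linD] by blast
  have "\<Phi> js 0 \<in> interior (\<Phi> js ` ball 0 1)"
  proof (rule sussmann_open_mapping[OF open_UNIV \<Phi>_cont _ \<Phi>_deriv[of js, unfolded D]])
    show "bounded_linear D'" using D'(1) by (simp add: linear_conv_bounded_linear)
  qed (use D' in auto)
  then obtain r where r: "r > 0" "ball 0 r \<subseteq> \<Phi> js ` ball 0 1"
    unfolding \<Phi>0 mem_interior by blast
  define K' where "K' is = (\<Sum>j\<leftarrow>is. K j + norm (v j) + K j)" for "is"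
  have reachable: "reachable (K' is) (\<Phi> is t)" if "t \<in> ball 0 1" for t "is"
  proof (induction "is")
    case Nil
    then show ?case by (simp add: K'_def reachable_0)
  next
    case (Cons j "is")
    have "\<bar>t $ j\<bar> \<le> 1" using that component_le_norm_cart[of t j] by simp
    then have "reachable (norm (v j)) (t $ j *\<^sub>R v j)"
      using hvK(3) subspace_layer
      by (intro reachable_mono[OF reachable_horizontal]) (auto intro: subspace_scale mult_left_le_one_le)
    then have "reachable (K j + norm (v j) + K j) (m (m (h j) (t $ j *\<^sub>R v j)) (- h j))"
      using hvK by (intro reachable_m reachable_inverse) auto
    also have "m (m (h j) (t $ j *\<^sub>R v j)) (- h j) = t $ j *\<^sub>R w j"
      by (simp add: hvK(1) linear_cmul[OF linear_Ad] flip: Ad_def)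
    finally show ?case
      using reachable_m[OF _ Cons] by (simp add: K'_def)
  qed
  show ?thesis
  proof (intro exI[of _ "K' js"] exI[of _ r] conjI allI impI, rule r(1))
    fix x :: "real^'n" assume "norm x < r"
    then have "x \<in> \<Phi> js ` ball 0 1" using r by auto
    then show "reachable (K' js) x" using reachable by blast
  qed
qed

text \<open>
  By homogeneity, a length bound near the origin becomes small on a smaller neighbourhood.
\<close>

lemma reachable_small:
  assumes "\<epsilon> > 0"
  shows "\<exists>r>0. \<forall>x. norm x < r \<longrightarrow> reachable \<epsilon> x"
proof -
  obtain K r where r: "r > 0" "\<And>x. norm x < r \<Longrightarrow> reachable K x"
    using reachable_neighbourhood by blast
  define c where "c = \<epsilon> / (\<bar>K\<bar> + 1)"
  have c: "c > 0" "c * K \<le> \<epsilon>"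
  proof -
    show "c > 0" using assms by (simp add: c_def add_nonneg_pos)
    have "c * K \<le> c * (\<bar>K\<bar> + 1)" using \<open>c > 0\<close> by (intro mult_left_mono) auto
    also have "\<dots> = \<epsilon>" by (simp add: c_def)
    finally show "c * K \<le> \<epsilon>" .
  qed
  have "bounded_linear (dil (1 / c))" using linear_dilation linear_conv_bounded_linear by blast
  then obtain L where L: "L > 0" "\<And>x. norm (dil (1 / c) x) \<le> norm x * L"
    using bounded_linear.pos_bounded by blast
  show ?thesis
  proof (intro exI[of _ "r / L"] conjI allI impI)
    show "r / L > 0" using r L by simp
    fix x :: "real^'n" assume "norm x < r / L"
    then have "norm (dil (1 / c) x) < r"
      using L(2)[of x] L(1) by (simp add: pos_less_divide_eq)
    then have "reachable (c * K) (dil c (dil (1 / c) x))"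
      using r c by (intro reachable_dil) auto
    then show "reachable \<epsilon> x"
      using c by (auto simp: dilation_dilation intro: reachable_mono)
  qed
qed

text \<open>
  A dilation moves any point into the neighbourhood of the origin that is known to be reachable.
\<close>

lemma reachable_everywhere: "\<exists>K. reachable K x"
proof -
  obtain K r where r: "r > 0" "\<And>x. norm x < r \<Longrightarrow> reachable K x"
    using reachable_neighbourhood by blast
  have "((\<lambda>c. dil c x) \<longlongrightarrow> dil 0 x) (at 0)"
    using dil_vd_0[of x] has_vector_derivative_continuous continuous_within by blast
  then have "\<forall>\<^sub>F c in at 0. norm (dil c x) < r"
    using r(1) tendstoD[of "\<lambda>c. dil c x" 0 "at 0" r] by simp
  then obtain d where d: "d > 0" "\<And>c. c \<noteq> 0 \<Longrightarrow> dist c 0 < d \<Longrightarrow> norm (dil c x) < r"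
    unfolding eventually_at by blast
  define c where "c = d / 2"
  have "c > 0" "norm (dil c x) < r" using d(1) d(2)[of c] by (auto simp: c_def)
  then have "reachable (1 / c * K) (dil (1 / c) (dil c x))"
    using r by (intro reachable_dil) auto
  then show ?thesis using \<open>c > 0\<close> by (auto simp: dilation_dilation)
qed

end


section \<open>Horizontal curves and their lengths\<close>

text \<open>Keeps the degree of the horizontal layer in the form \<open>1\<close> that the definitions use.\<close>

declare One_nat_def [simp del]

lemma C1_imp_lipschitz_on_bounded:
  fixes f :: "real^'n \<Rightarrow> real^'k"
  assumes deriv: "\<And>y. (f has_derivative F y) (at y)"
    and cont: "\<And>v. continuous_on UNIV (\<lambda>y. F y v)"
    and "bounded S"
  shows "\<exists>L. L-lipschitz_on S f"
proof -
  obtain R where "\<forall>x\<in>S. norm x \<le> R" using \<open>bounded S\<close> unfolding bounded_iff ..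
  then have R: "S \<subseteq> cball 0 R" by auto
  have "\<exists>B\<ge>0. \<forall>y\<in>cball 0 R. norm (F y (axis i 1)) \<le> B" for i
  proof -
    have "compact ((\<lambda>y. F y (axis i 1)) ` cball 0 R)"
      by (intro compact_continuous_image continuous_on_subset[OF cont]) auto
    then have "bounded ((\<lambda>y. F y (axis i 1)) ` cball 0 R)" by (rule compact_imp_bounded)
    then obtain B where "B > 0" "\<forall>x\<in>(\<lambda>y. F y (axis i 1)) ` cball 0 R. norm x \<le> B"
      unfolding bounded_pos by blast
    then show ?thesis by (intro exI[of _ B]) auto
  qed
  then obtain B where B: "\<And>i. B i \<ge> 0" "\<And>i y. y \<in> cball 0 R \<Longrightarrow> norm (F y (axis i 1)) \<le> B i"
    by metis
  define L where "L = (\<Sum>i\<in>UNIV. B i)"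
  have onorm: "onorm (F y) \<le> L" if "y \<in> cball 0 R" for y
  proof (rule onorm_le)
    fix v
    have lin: "linear (F y)" by (rule has_derivative_linear[OF deriv])
    have "F y v = F y (\<Sum>i\<in>UNIV. v $ i *\<^sub>R axis i 1)"
      using basis_expansion[of v] by (simp add: scalar_mult_eq_scaleR)
    also have "\<dots> = (\<Sum>i\<in>UNIV. v $ i *\<^sub>R F y (axis i 1))"
      by (simp add: linear_sum[OF lin] linear_cmul[OF lin])
    also have "norm \<dots> \<le> (\<Sum>i\<in>UNIV. norm v * B i)"
    proof (rule sum_norm_le)
      fix i
      show "norm (v $ i *\<^sub>R F y (axis i 1)) \<le> norm v * B i"
        unfolding norm_scaleR real_norm_def
        using B that by (intro mult_mono component_le_norm_cart) auto
    qed
    finally show "norm (F y v) \<le> L * norm v"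
      by (simp add: L_def sum_distrib_left mult.commute)
  qed
  have "L-lipschitz_on S f"
  proof (rule lipschitz_onI)
    show "L \<ge> 0" unfolding L_def by (intro sum_nonneg B)
    fix x y assume "x \<in> S" "y \<in> S"
    then show "dist (f x) (f y) \<le> L * dist x y"
      unfolding dist_norm
      using R by (intro differentiable_bound[OF convex_cball[of 0 R] has_derivative_at_withinI[OF deriv] onorm]) auto
  qed
  then show ?thesis ..
qed

lemma absolutely_integrable_combine_real:
  fixes f :: "real \<Rightarrow> real"
  assumes "f absolutely_integrable_on {a..c}" "f absolutely_integrable_on {c..b}" "a \<le> c" "c \<le> b"
  shows "f absolutely_integrable_on {a..b}"
  using assms Henstock_Kurzweil_Integration.integrable_combine[of a c b]
  unfolding absolutely_integrable_on_def by blast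

context carnot
begin

definition joined :: "real^'n \<Rightarrow> real^'n \<Rightarrow> real \<Rightarrow> bool" where
  "joined x y l \<longleftrightarrow> (\<exists>a b \<gamma> u. a \<le> b \<and> horizontal_with m deg a b \<gamma> u \<and>
      \<gamma> a = x \<and> \<gamma> b = y \<and> curve_length deg a b u = l)"

lemma cc_dist_eq_Inf: "cc_dist m deg x y = Inf {l. joined x y l}"
  unfolding cc_dist_def joined_def by (rule arg_cong[where f = Inf]) blast

text \<open>
  Left translations (\<open>c = 1\<close>) and dilations carry horizontal fields to horizontal fields, up to the
  factor \<open>c\<close>; this is what determines their effect on the length.
\<close>

lemma joined_image:
  assumes deriv: "\<And>y. (f has_derivative F y) (at y)"
    and cont: "\<And>v. continuous_on UNIV (\<lambda>y. F y v)"
    and field: "\<And>v y. v \<in> V 1 \<Longrightarrow> F y (X v y) = X (c *\<^sub>R v) (f y)"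
    and "joined x y l"
  shows "joined (f x) (f y) (\<bar>c\<bar> * l)"
proof -
  obtain a b \<gamma> u where \<gamma>: "a \<le> b" "horizontal_with m deg a b \<gamma> u" "\<gamma> a = x" "\<gamma> b = y"
    and l: "curve_length deg a b u = l"
    using \<open>joined x y l\<close> unfolding joined_def by blast
  have ac: "abs_cont_on a b \<gamma>" using \<gamma>(2) by (simp add: horizontal_with_def)
  have "bounded (\<gamma> ` {a..b})"
    by (intro compact_imp_bounded compact_continuous_image abs_cont_on_imp_continuous[OF ac]) simp
  then obtain L where "L-lipschitz_on (\<gamma> ` {a..b}) f"
    using C1_imp_lipschitz_on_bounded[OF deriv cont] by blast
  then have ac': "abs_cont_on a b (\<lambda>t. f (\<gamma> t))"
    by (rule abs_cont_on_lipschitz_compose[OF ac])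
  have vd: "((\<lambda>t. f (\<gamma> t)) has_vector_derivative (\<Sum>j | deg j = 1. (c * u j t) *\<^sub>R X (axis j 1) (f (\<gamma> t))))
          (at t within {a..b})"
    if "(\<gamma> has_vector_derivative (\<Sum>j | deg j = 1. u j t *\<^sub>R X (axis j 1) (\<gamma> t))) (at t within {a..b})" for t
  proof -
    have lin: "linear (F (\<gamma> t))" by (rule has_derivative_linear[OF deriv])
    have "F (\<gamma> t) (X (axis j 1) (\<gamma> t)) = c *\<^sub>R X (axis j 1) (f (\<gamma> t))" if "deg j = 1" for j
    proof -
      have "axis j 1 \<in> V 1" using that by (auto simp: layer_def intro: span_base)
      then show ?thesis by (simp add: field linear_cmul[OF linear_X])
    qed
    then have "F (\<gamma> t) (\<Sum>j | deg j = 1. u j t *\<^sub>R X (axis j 1) (\<gamma> t))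
        = (\<Sum>j | deg j = 1. (c * u j t) *\<^sub>R X (axis j 1) (f (\<gamma> t)))"
      by (simp add: linear_sum[OF lin] linear_cmul[OF lin] mult.commute)
    then show ?thesis
      using vector_derivative_diff_chain_within[OF that has_derivative_at_withinI[OF deriv]]
      by (simp add: o_def)
  qed
  have "AE t in lebesgue_on {a..b}.
      (\<gamma> has_vector_derivative (\<Sum>j | deg j = 1. u j t *\<^sub>R X (axis j 1) (\<gamma> t))) (at t within {a..b})"
    using \<gamma>(2) unfolding horizontal_with_def by blast
  then have "AE t in lebesgue_on {a..b}. ((\<lambda>t. f (\<gamma> t)) has_vector_derivative
      (\<Sum>j | deg j = 1. (c * u j t) *\<^sub>R X (axis j 1) (f (\<gamma> t)))) (at t within {a..b})"
    by (rule eventually_mono) (rule vd)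
  moreover have "(\<lambda>t. c * u j t) absolutely_integrable_on {a..b}" if "deg j = 1" for j
    using absolutely_integrable_scaleR_left[where f = "u j" and S = "{a..b}" and c = c] \<gamma>(2) that
    by (simp add: horizontal_with_def)
  ultimately have "horizontal_with m deg a b (\<lambda>t. f (\<gamma> t)) (\<lambda>j t. c * u j t)"
    using ac' by (simp add: horizontal_with_def)
  moreover have "curve_length deg a b (\<lambda>j t. c * u j t) = \<bar>c\<bar> * l"
  proof -
    have "sqrt (\<Sum>j | deg j = 1. (c * u j t)\<^sup>2) = \<bar>c\<bar> * sqrt (\<Sum>j | deg j = 1. (u j t)\<^sup>2)" for t
      by (simp add: power_mult_distrib real_sqrt_mult flip: sum_distrib_left)
    then show ?thesis using l by (simp add: curve_length_def)
  qed
  ultimately show ?thesis unfolding joined_def using \<gamma> by blast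
qed

lemma joined_translate:
  assumes "joined x y l"
  shows "joined (m z x) (m z y) l"
proof -
  have "continuous_on UNIV (\<lambda>y. Dm z y 0 v)" for v
    using continuous_on_compose2[OF Dm_continuous[of UNIV 0 v], of UNIV "\<lambda>y. (z, y)"]
    by (simp add: continuous_on_Pair)
  from joined_image[OF left_mult_has_derivative this _ assms, where c = 1]
  show ?thesis by (simp add: X_left_translate)
qed

lemma joined_dil:
  assumes "joined x y l"
  shows "joined (dil c x) (dil c y) (\<bar>c\<bar> * l)"
proof (rule joined_image[OF _ _ _ assms])
  show "(dil c has_derivative dil c) (at y)" for y
    by (rule linear_imp_has_derivative[OF linear_dilation])
qed (simp_all add: dil_X dil_horizontal)

lemma joined_sym:
  assumes "joined x y l"
  shows "joined y x l"
proof -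
  obtain a b \<gamma> u where \<gamma>: "a \<le> b" "horizontal_with m deg a b \<gamma> u" "\<gamma> a = x" "\<gamma> b = y"
    and l: "curve_length deg a b u = l"
    using assms unfolding joined_def by blast
  define P where "P t \<longleftrightarrow> (\<gamma> has_vector_derivative (\<Sum>j | deg j = 1. u j t *\<^sub>R X (axis j 1) (\<gamma> t))) (at t within {a..b})" for t
  have vd: "((\<lambda>t. \<gamma> (- t)) has_vector_derivative (\<Sum>j | deg j = 1. (- u j (- t)) *\<^sub>R X (axis j 1) (\<gamma> (- t))))
     (at t within {-b..-a})" if "P (- t)" for t
  proof -
    have "(uminus has_vector_derivative -1) (at t within {-b..-a})"
      by (auto intro!: derivative_eq_intros)
    moreover have "(\<gamma> has_vector_derivative (\<Sum>j | deg j = 1. u j (- t) *\<^sub>R X (axis j 1) (\<gamma> (- t)))) (at (- t) within uminus ` {-b..-a})"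
      using that by (simp add: P_def)
    ultimately have "(\<gamma> \<circ> uminus has_vector_derivative
        (-1) *\<^sub>R (\<Sum>j | deg j = 1. u j (- t) *\<^sub>R X (axis j 1) (\<gamma> (- t)))) (at t within {-b..-a})"
      by (rule vector_diff_chain_within)
    then show ?thesis by (simp add: o_def sum_negf)
  qed
  have "negligible {t \<in> {a..b}. \<not> P t}"
    using \<gamma>(2) by (simp add: horizontal_with_def P_def AE_lebesgue_on_iff_negligible)
  from negligible_uminus[OF this]
  have "negligible {t \<in> {-b..-a}. \<not> P (- t)}"
    by (rule negligible_subset) auto
  then have "AE t in lebesgue_on {-b..-a}. P (- t)"
    by (simp add: AE_lebesgue_on_iff_negligible)
  then have "AE t in lebesgue_on {-b..-a}. ((\<lambda>t. \<gamma> (- t)) has_vector_derivative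
     (\<Sum>j | deg j = 1. (- u j (- t)) *\<^sub>R X (axis j 1) (\<gamma> (- t)))) (at t within {-b..-a})"
    by (rule eventually_mono) (rule vd)
  moreover have "(\<lambda>t. - u j (- t)) absolutely_integrable_on {-b..-a}" if "deg j = 1" for j
    using absolutely_integrable_scaleR_left[where f = "\<lambda>t. u j (- t)" and S = "{-b..-a}" and c = "-1"] \<gamma>(2) that
    by (simp add: horizontal_with_def)
  ultimately have "horizontal_with m deg (- b) (- a) (\<lambda>t. \<gamma> (- t)) (\<lambda>j t. - u j (- t))"
    using \<gamma>(2) by (simp add: horizontal_with_def abs_cont_on_reflect)
  moreover have "curve_length deg (- b) (- a) (\<lambda>j t. - u j (- t)) = l"
    using l Henstock_Kurzweil_Integration.integral_reflect_real[of b a "\<lambda>t. sqrt (\<Sum>j | deg j = 1. (u j t)\<^sup>2)"]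
    by (simp add: curve_length_def)
  ultimately show ?thesis
    unfolding joined_def using \<gamma>
    by (intro exI[of _ "- b"] exI[of _ "- a"] exI[of _ "\<lambda>t. \<gamma> (- t)"] exI[of _ "\<lambda>j t. - u j (- t)"]) simp
qed

text \<open>
  The horizontal projection of the curve has the velocity \<open>\<Sum> u\<^sub>j X\<^sub>j\<close> in the Euclidean space \<open>V 1\<close>,
  whose norm is the integrand of the length. So the chord of the projection is at most as long.
\<close>

lemma norm_hproj_le_joined:
  assumes "joined x y l"
  shows "norm (hproj deg y - hproj deg x) \<le> l"
proof -
  obtain a b \<gamma> u where \<gamma>: "a \<le> b" "horizontal_with m deg a b \<gamma> u" "\<gamma> a = x" "\<gamma> b = y"
    and l: "curve_length deg a b u = l"
    using assms unfolding joined_def by blast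
  define v where "v t = (\<Sum>j | deg j = 1. u j t *\<^sub>R axis j (1::real))" for t
  define N where "N = {t \<in> {a..b}. \<not> (\<gamma> has_vector_derivative (\<Sum>j | deg j = 1. u j t *\<^sub>R X (axis j 1) (\<gamma> t))) (at t within {a..b})}"
  have N: "negligible N"
    using \<gamma>(2) by (simp add: horizontal_with_def N_def AE_lebesgue_on_iff_negligible)
  have v1: "v t \<in> V 1" for t
    unfolding v_def layer_def by (intro span_sum span_scale span_base) auto
  have vj: "v t $ j = u j t" if "deg j = 1" for t j
  proof -
    have "v t $ j = (\<Sum>i | deg i = 1. if i = j then u j t else 0)"
      unfolding v_def sum_component by (intro sum.cong) (auto simp: axis_def)
    then show ?thesis using that by simp
  qed
  have lip: "1-lipschitz_on (\<gamma> ` {a..b}) (hproj deg)"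
  proof (rule lipschitz_onI)
    fix p q
    have "norm (hproj deg (p - q)) \<le> norm (p - q)"
      by (rule norm_le_componentwise_cart) (simp add: hproj_def)
    then show "dist (hproj deg p) (hproj deg q) \<le> 1 * dist p q"
      by (simp add: dist_norm linear_diff[OF linear_hproj])
  qed simp
  then have ac: "abs_cont_on a b (\<lambda>t. hproj deg (\<gamma> t))"
    using \<gamma>(2) by (intro abs_cont_on_lipschitz_compose[OF _ lip]) (simp add: horizontal_with_def)
  have "(v has_integral hproj deg (\<gamma> b) - hproj deg (\<gamma> a)) {a..b}"
  proof (rule fundamental_theorem_of_calculus_abs_cont[OF \<gamma>(1) ac N])
    fix t assume "t \<in> {a..b} - N"
    then have "(\<gamma> has_vector_derivative (\<Sum>j | deg j = 1. u j t *\<^sub>R X (axis j 1) (\<gamma> t))) (at t within {a..b})"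
      by (simp add: N_def)
    from linear_vd[OF linear_hproj this]
    have "((\<lambda>t. hproj deg (\<gamma> t)) has_vector_derivative hproj deg (\<Sum>j | deg j = 1. u j t *\<^sub>R X (axis j 1) (\<gamma> t))) (at t within {a..b})" .
    also have "hproj deg (\<Sum>j | deg j = 1. u j t *\<^sub>R X (axis j 1) (\<gamma> t)) = hproj deg (v t)"
      by (simp add: v_def linear_sum[OF linear_hproj] linear_cmul[OF linear_hproj] hproj_X)
    also have "\<dots> = v t" by (rule hproj_layer_1[OF v1])
    finally show "((\<lambda>t. hproj deg (\<gamma> t)) has_vector_derivative v t) (at t within {a..b})" .
  qed
  then have int: "integral {a..b} v = hproj deg y - hproj deg x" and vint: "v integrable_on {a..b}"
    using \<gamma> by auto
  have "v absolutely_integrable_on {a..b}"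
    unfolding v_def using \<gamma>(2)
    by (intro absolutely_integrable_sum absolutely_integrable_scaleR_right) (auto simp: horizontal_with_def)
  then have "(\<lambda>t. norm (v t)) integrable_on {a..b}"
    by (simp add: absolutely_integrable_on_def)
  then have "norm (integral {a..b} v) \<le> integral {a..b} (\<lambda>t. norm (v t))"
    by (intro Henstock_Kurzweil_Integration.integral_norm_bound_integral vint) auto
  also have "(\<lambda>t. norm (v t)) = (\<lambda>t. sqrt (\<Sum>j | deg j = 1. (u j t)\<^sup>2))"
    using norm_layer_1[OF v1] vj by simp
  finally show ?thesis using int l by (simp add: curve_length_def)
qed

text \<open>
  The broken line of a list, built by appending one segment at a time. Lipschitz continuity and
  differentiability off a finite set are carried along because they pass to concatenations more
  directly than absolute continuity and differentiability almost everywhere, which they imply.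
\<close>

lemma piecewise_curve:
  assumes "set vs \<subseteq> V 1"
  shows "\<exists>b L S \<gamma> u. 0 \<le> b \<and> L-lipschitz_on {0..b} \<gamma> \<and> finite S \<and>
     (\<forall>t\<in>{0<..<b} - S. (\<gamma> has_vector_derivative (\<Sum>j | deg j = 1. u j t *\<^sub>R X (axis j 1) (\<gamma> t))) (at t)) \<and>
     (\<forall>j. u j absolutely_integrable_on {0..b}) \<and>
     ((\<lambda>t. sqrt (\<Sum>j | deg j = 1. (u j t)\<^sup>2)) has_integral (\<Sum>v\<leftarrow>vs. norm v)) {0..b} \<and>
     \<gamma> 0 = 0 \<and> \<gamma> b = hprod vs"
  using assms
proof (induction vs rule: rev_induct)
  case Nil
  show ?case
    by (intro exI[of _ 0] exI[of _ "{}"] exI[of _ "\<lambda>_. 0"] exI[of _ "\<lambda>_ _. 0"])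
      (auto simp: lipschitz_on_def)
next
  case (snoc v vs)
  then have "set vs \<subseteq> V 1" by simp
  from snoc.IH[OF this] obtain b L S \<gamma> u where b: "0 \<le> b" and L: "L-lipschitz_on {0..b} \<gamma>" and S: "finite S" and
    vd: "\<forall>t\<in>{0<..<b} - S. (\<gamma> has_vector_derivative (\<Sum>j | deg j = 1. u j t *\<^sub>R X (axis j 1) (\<gamma> t))) (at t)" and
    u: "\<forall>j. u j absolutely_integrable_on {0..b}" and
    len: "((\<lambda>t. sqrt (\<Sum>j | deg j = 1. (u j t)\<^sup>2)) has_integral (\<Sum>v\<leftarrow>vs. norm v)) {0..b}" and
    ends: "\<gamma> 0 = 0" "\<gamma> b = hprod vs"
    by (elim exE conjE)
  have v: "v \<in> V 1" using snoc.prems by simp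
  define x where "x = hprod vs"
  define \<beta> where "\<beta> t = m x ((t - b) *\<^sub>R v)" for t
  define \<gamma>' where "\<gamma>' t = (if t \<le> b then \<gamma> t else \<beta> t)" for t
  define u' where "u' j t = (if t \<le> b then u j t else v $ j)" for j t
  have X_v: "X v y = (\<Sum>j | deg j = 1. v $ j *\<^sub>R X (axis j 1) y)" for y
    unfolding X_expand[of v] using v
    by (intro sum.mono_neutral_right) (auto simp: mem_layer_iff)
  obtain L' where L': "L'-lipschitz_on {b..b+1} \<beta>"
  proof -
    have "continuous_on UNIV (\<lambda>y. Dm x y 0 v)" for v
      using continuous_on_compose2[OF Dm_continuous[of UNIV 0 v], of UNIV "\<lambda>y. (x, y)"]
      by (simp add: continuous_on_Pair)
    moreover have "bounded ((\<lambda>t. (t - b) *\<^sub>R v) ` {b..b+1})"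
      by (intro compact_imp_bounded compact_continuous_image continuous_intros) simp
    ultimately obtain K where K: "K-lipschitz_on ((\<lambda>t. (t - b) *\<^sub>R v) ` {b..b+1}) (m x)"
      using C1_imp_lipschitz_on_bounded[OF left_mult_has_derivative] by blast
    have "(norm v)-lipschitz_on {b..b+1} (\<lambda>t. (t - b) *\<^sub>R v)"
      by (rule lipschitz_onI) (simp_all add: dist_norm mult.commute flip: scaleR_diff_left)
    from lipschitz_on_compose[OF this K] show ?thesis
      using that by (simp add: o_def \<beta>_def[abs_def])
  qed
  have \<beta>b: "\<gamma> b = \<beta> b" using ends by (simp add: \<beta>_def x_def)
  have lip: "(max L L')-lipschitz_on {0..b+1} \<gamma>'"
    unfolding \<gamma>'_def[abs_def] by (rule lipschitz_on_concat_max[OF L L' \<beta>b])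
  have vd': "(\<gamma>' has_vector_derivative (\<Sum>j | deg j = 1. u' j t *\<^sub>R X (axis j 1) (\<gamma>' t))) (at t)"
    if t: "t \<in> {0<..<b+1} - insert b S" for t
  proof (cases "t < b")
    case True
    then have "(\<gamma> has_vector_derivative (\<Sum>j | deg j = 1. u' j t *\<^sub>R X (axis j 1) (\<gamma>' t))) (at t)"
      using t vd by (simp add: u'_def \<gamma>'_def)
    then show ?thesis
      by (rule has_vector_derivative_transform_within_open[where S = "{..<b}"]) (use True in \<open>auto simp: \<gamma>'_def\<close>)
  next
    case False
    have "(\<beta> has_vector_derivative X v (\<beta> t)) (at t)"
    proof (rule vd_shift)
      have "((\<lambda>h. m x (((t - b) + h) *\<^sub>R v)) has_vector_derivative X v (\<beta> t)) (at 0)"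
      proof -
        have "m x (((t - b) + h) *\<^sub>R v) = m (\<beta> t) (h *\<^sub>R v)" for h
          by (simp only: \<beta>_def ray[symmetric] G.assoc)
        then show ?thesis using X_vd[OF line_vd, of 0 v "\<beta> t"] by simp
      qed
      then show "((\<lambda>h. \<beta> (t + h)) has_vector_derivative X v (\<beta> t)) (at 0)"
        by (simp add: \<beta>_def algebra_simps)
    qed
    then have "(\<beta> has_vector_derivative (\<Sum>j | deg j = 1. u' j t *\<^sub>R X (axis j 1) (\<gamma>' t))) (at t)"
      using t False by (simp add: u'_def \<gamma>'_def X_v[of "\<beta> t"])
    then show ?thesis
      by (rule has_vector_derivative_transform_within_open[where S = "{b<..}"]) (use False t in \<open>auto simp: \<gamma>'_def\<close>)
  qed
  have ai: "u' j absolutely_integrable_on {0..b+1}" for j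
  proof (rule absolutely_integrable_combine_real[where c = b])
    show "u' j absolutely_integrable_on {0..b}"
      by (rule absolutely_integrable_spike[OF u[rule_format, of j], where S = "{}"]) (auto simp: u'_def)
    show "u' j absolutely_integrable_on {b..b+1}"
      by (rule absolutely_integrable_spike[where f = "\<lambda>_. v $ j" and S = "{b}"]) (auto simp: u'_def)
  qed (use b in auto)
  have len': "((\<lambda>t. sqrt (\<Sum>j | deg j = 1. (u' j t)\<^sup>2)) has_integral (\<Sum>v\<leftarrow>vs. norm v) + norm v) {0..b+1}"
  proof (rule Henstock_Kurzweil_Integration.has_integral_combine[where c = b])
    show "((\<lambda>t. sqrt (\<Sum>j | deg j = 1. (u' j t)\<^sup>2)) has_integral (\<Sum>v\<leftarrow>vs. norm v)) {0..b}"
      by (rule has_integral_spike[OF negligible_empty _ len]) (auto simp: u'_def)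
    have "((\<lambda>t. norm v) has_integral norm v) {b..b+1}"
      using has_integral_const_real[of "norm v" b "b + 1"] by simp
    then show "((\<lambda>t. sqrt (\<Sum>j | deg j = 1. (u' j t)\<^sup>2)) has_integral norm v) {b..b+1}"
      by (rule has_integral_spike[of "{b}", rotated 2]) (auto simp: u'_def norm_layer_1[OF v])
  qed (use b in auto)
  have ends': "\<gamma>' 0 = 0" "\<gamma>' (b + 1) = hprod (vs @ [v])"
    using b ends by (simp_all add: \<gamma>'_def \<beta>_def x_def hprod_append)
  show ?case
    by (intro exI[of _ "b + 1"] exI[of _ "max L L'"] exI[of _ "insert b S"] exI[of _ \<gamma>'] exI[of _ u'])
      (use b S lip vd' ai len' ends' in auto)
qed

lemma reachable_imp_joined:
  assumes "reachable K x"
  shows "\<exists>l\<le>K. joined 0 x l"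
proof -
  obtain vs where vs: "set vs \<subseteq> V 1" "hprod vs = x" "(\<Sum>v\<leftarrow>vs. norm v) \<le> K"
    using assms unfolding reachable_def by blast
  obtain b L S \<gamma> u where b: "0 \<le> b" and L: "L-lipschitz_on {0..b} \<gamma>" and S: "finite S" and
    vd: "\<forall>t\<in>{0<..<b} - S. (\<gamma> has_vector_derivative (\<Sum>j | deg j = 1. u j t *\<^sub>R X (axis j 1) (\<gamma> t))) (at t)" and
    u: "\<forall>j. u j absolutely_integrable_on {0..b}" and
    len: "((\<lambda>t. sqrt (\<Sum>j | deg j = 1. (u j t)\<^sup>2)) has_integral (\<Sum>v\<leftarrow>vs. norm v)) {0..b}" and
    ends: "\<gamma> 0 = 0" "\<gamma> b = hprod vs"
    using piecewise_curve[OF vs(1)] by (elim exE conjE)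
  have "negligible (S \<union> {0, b})" using S by (intro negligible_finite) simp
  then have "negligible {t \<in> {0..b}. \<not> (\<gamma> has_vector_derivative (\<Sum>j | deg j = 1. u j t *\<^sub>R X (axis j 1) (\<gamma> t))) (at t within {0..b})}"
  proof (rule negligible_subset, intro subsetI)
    fix t assume t: "t \<in> {t \<in> {0..b}. \<not> (\<gamma> has_vector_derivative (\<Sum>j | deg j = 1. u j t *\<^sub>R X (axis j 1) (\<gamma> t))) (at t within {0..b})}"
    then have "t \<notin> {0<..<b} - S" using vd has_vector_derivative_at_within by blast
    then show "t \<in> S \<union> {0, b}" using t by auto
  qed
  then have "horizontal_with m deg 0 b \<gamma> u"
    using u lipschitz_imp_abs_cont_on[OF L] by (simp add: horizontal_with_def AE_lebesgue_on_iff_negligible)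
  moreover have "curve_length deg 0 b u = (\<Sum>v\<leftarrow>vs. norm v)"
    using len by (simp add: curve_length_def integral_unique)
  ultimately have "joined 0 x (\<Sum>v\<leftarrow>vs. norm v)"
    unfolding joined_def using b ends vs(2) by blast
  then show ?thesis using vs(3) by blast
qed

section \<open>The Carnot-Caratheodory distance\<close>

lemma joined_exists: "\<exists>l. joined x y l"
proof -
  obtain K where "reachable K (m (- x) y)" using reachable_everywhere by blast
  then obtain l where "joined 0 (m (- x) y) l" using reachable_imp_joined by blast
  from joined_translate[OF this, of x] show ?thesis by auto
qed

lemma joined_nonneg: "joined x y l \<Longrightarrow> 0 \<le> l"
  by (rule order_trans[OF norm_ge_zero norm_hproj_le_joined])

lemma cc_dist_le: "joined x y l \<Longrightarrow> cc_dist m deg x y \<le> l"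
  unfolding cc_dist_eq_Inf by (rule cInf_lower) (auto intro!: bdd_belowI[of _ 0] joined_nonneg)

lemma cc_dist_ge: "(\<And>l. joined x y l \<Longrightarrow> K \<le> l) \<Longrightarrow> K \<le> cc_dist m deg x y"
  unfolding cc_dist_eq_Inf using joined_exists by (intro cInf_greatest) auto

lemma cc_dist_nonneg: "0 \<le> cc_dist m deg x y"
  by (rule cc_dist_ge) (rule joined_nonneg)

lemma cc_dist_sym: "cc_dist m deg x y = cc_dist m deg y x"
proof (rule antisym)
  show "cc_dist m deg x y \<le> cc_dist m deg y x"
    by (rule cc_dist_ge) (rule cc_dist_le[OF joined_sym])
  show "cc_dist m deg y x \<le> cc_dist m deg x y"
    by (rule cc_dist_ge) (rule cc_dist_le[OF joined_sym])
qed

lemma cc_dist_translate: "cc_dist m deg (m z x) (m z y) = cc_dist m deg x y"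
proof (rule antisym)
  show "cc_dist m deg (m z x) (m z y) \<le> cc_dist m deg x y"
    by (rule cc_dist_ge) (rule cc_dist_le[OF joined_translate])
  show "cc_dist m deg x y \<le> cc_dist m deg (m z x) (m z y)"
  proof (rule cc_dist_ge)
    fix l assume "joined (m z x) (m z y) l"
    from joined_translate[OF this, of "- z"] show "cc_dist m deg x y \<le> l"
      by (intro cc_dist_le) simp
  qed
qed

lemma cc_dist_dil_le:
  assumes "c > 0"
  shows "cc_dist m deg (dil c x) (dil c y) \<le> c * cc_dist m deg x y"
proof -
  have "cc_dist m deg (dil c x) (dil c y) / c \<le> cc_dist m deg x y"
  proof (rule cc_dist_ge)
    fix l assume "joined x y l"
    from cc_dist_le[OF joined_dil[OF this, of c]] assms
    show "cc_dist m deg (dil c x) (dil c y) / c \<le> l" by (simp add: field_simps)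
  qed
  then show ?thesis using assms by (simp add: field_simps)
qed

lemma norm_hproj_le_cc_dist: "norm (hproj deg y - hproj deg x) \<le> cc_dist m deg x y"
  by (rule cc_dist_ge) (rule norm_hproj_le_joined)

lemma cc_dist_reach:
  assumes "reachable K x"
  shows "cc_dist m deg 0 x \<le> K"
proof -
  obtain l where "l \<le> K" "joined 0 x l" using reachable_imp_joined[OF assms] by blast
  then show ?thesis using cc_dist_le by force
qed

text \<open>
  By \<open>reachable_small\<close> and left-invariance. Euclidean neighbourhoods matter because the limit in the
  definition of Pansu differentiability is taken along them.
\<close>

lemma cc_dist_small:
  assumes "\<epsilon> > 0"
  shows "\<forall>\<^sub>F y in at x. cc_dist m deg x y \<le> \<epsilon>"
proof -
  obtain r where r: "r > 0" "\<forall>x. norm x < r \<longrightarrow> reachable \<epsilon> x"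
    using reachable_small[OF assms] by (elim exE conjE)
  have "((\<lambda>y. m (- x) y) \<longlongrightarrow> m (- x) x) (at x)"
    using has_derivative_continuous[OF left_mult_has_derivative[of "- x" x]]
    by (simp add: continuous_within)
  then have "\<forall>\<^sub>F y in at x. norm (m (- x) y) < r"
    using r(1) by (auto dest!: tendstoD simp: dist_norm)
  then show ?thesis
  proof (rule eventually_mono)
    fix y assume "norm (m (- x) y) < r"
    then have "cc_dist m deg 0 (m (- x) y) \<le> \<epsilon>" using r(2) by (simp add: cc_dist_reach)
    then show "cc_dist m deg x y \<le> \<epsilon>"
      using cc_dist_translate[of x 0 "m (- x) y"] by simp
  qed
qed

lemma G_linear_inner:
  assumes E: "E \<in> V 1"
  shows "G_linear m deg (\<lambda>x. x \<bullet> E)"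
  unfolding G_linear_def
proof (intro conjI allI impI)
  fix x y
  show "m x y \<bullet> E = x \<bullet> E + y \<bullet> E"
    using hproj_inner[OF E, of "m x y"] hproj_inner[OF E, of x] hproj_inner[OF E, of y]
    by (simp add: hproj_m inner_add_left)
  fix c :: real
  have "hproj deg (dil c x) = c *\<^sub>R hproj deg x" by (simp add: hproj_def dilation_def vec_eq_iff)
  then show "dil c x \<bullet> E = c * (x \<bullet> E)"
    using hproj_inner[OF E, of "dil c x"] hproj_inner[OF E, of x] by simp
qed

lemma cc_dist_unit_horizontal:
  assumes "E \<in> V 1" "norm E = 1"
  shows "cc_dist m deg E 0 = 1"
proof (rule antisym)
  show "cc_dist m deg E 0 \<le> 1"
    using cc_dist_reach[OF reachable_horizontal[OF assms(1)]] assms(2) cc_dist_sym[of E 0] by simp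
  show "1 \<le> cc_dist m deg E 0"
    using norm_hproj_le_cc_dist[of 0 E] assms by (simp add: hproj_layer_1 linear_0[OF linear_hproj])
qed

lemma inner_le_cc_dist:
  assumes E: "E \<in> V 1" "norm E = 1"
  shows "x \<bullet> E \<le> cc_dist m deg x 0"
proof -
  have "x \<bullet> E = hproj deg x \<bullet> E" using hproj_inner[OF E(1)] by simp
  also have "\<dots> \<le> norm (hproj deg x) * norm E" by (rule norm_cauchy_schwarz)
  also have "\<dots> \<le> cc_dist m deg x 0"
    using norm_hproj_le_cc_dist[of 0 x] E by (simp add: linear_0[OF linear_hproj])
  finally show ?thesis .
qed

text \<open>
  The infimum that defines the Lipschitz constant is attained: the set of bounds is closed.
\<close>

lemma cc_Lip_bound:
  assumes "cc_lipschitz m deg g"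
  shows "cc_dist m deg (g a) (g b) \<le> cc_Lip m deg g * \<bar>a - b\<bar>"
proof (cases "a = b")
  case True
  obtain C where "\<forall>a b. cc_dist m deg (g a) (g b) \<le> C * \<bar>a - b\<bar>"
    using assms unfolding cc_lipschitz_def cc_lipschitz_bounds_def by auto
  then have "cc_dist m deg (g a) (g b) \<le> C * \<bar>a - b\<bar>" by simp
  then show ?thesis using True by simp
next
  case False
  have "cc_dist m deg (g a) (g b) / \<bar>a - b\<bar> \<le> cc_Lip m deg g"
    unfolding cc_Lip_def using assms False
    by (intro cInf_greatest) (auto simp: cc_lipschitz_def cc_lipschitz_bounds_def divide_le_eq)
  then show ?thesis using False by (simp add: divide_le_eq)
qed

end

section \<open>Differentiability at a deformable direction\<close>

text \<open>
  The derivative is \<open>x \<mapsto> x \<bullet> E\<close>. With \<open>q = E\<^sup>-\<^sup>1 y\<close> and \<open>D = d(E, y) = d(q)\<close>, the projection gives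
  \<open>1 + q \<bullet> E \<le> d(y)\<close>. For the upper bound, \<open>d(y) = d(q, E\<^sup>-\<^sup>1)\<close>, and both points lie on one
  deformed line, at the parameters \<open>q \<bullet> E\<close> and \<open>-1\<close>.
\<close>

theorem proposition3p1:
  fixes m :: "real^'n \<Rightarrow> real^'n \<Rightarrow> real^'n"
    and deg :: "'n \<Rightarrow> nat"
    and s :: nat
    and E :: "real^'n"
  assumes "carnot_group m deg s"
    and "E \<in> layer deg 1"
    and "omega deg E = 1"
    and "deformable m deg E"
  shows "pansu_differentiable m deg (\<lambda>x. cc_dist m deg x 0) E"
proof -
  interpret carnot m deg s by (rule carnot.intro) (rule assms(1))
  let ?d = "cc_dist m deg"
  have E: "E \<in> V 1" "norm E = 1"
    using assms(2,3) norm_layer_1[OF assms(2)] by (simp_all add: omega_def)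
  obtain C :: real and N :: nat and \<Delta>\<^sub>E :: "real \<Rightarrow> real" where pos: "\<forall>\<eta>>0. \<Delta>\<^sub>E \<eta> > 0"
    and curve: "\<forall>l \<eta> \<Delta> u.
           0 < l \<and> l < 1 \<and> 0 < \<eta> \<and> 0 < \<Delta> \<and> \<Delta> < \<Delta>\<^sub>E \<eta> \<and> ?d u 0 \<le> 1 \<longrightarrow>
           (\<exists>g. cc_lipschitz m deg g \<and> horizontal_on_line m deg g \<and>
              joins_horizontal_lines m deg N g \<and>
              (\<forall>t. \<bar>t\<bar> \<ge> l \<longrightarrow> g t = t *\<^sub>R E) \<and>
              g (dil (\<Delta> * l) u \<bullet> E) = dil (\<Delta> * l) u \<and>
              cc_Lip m deg g \<le> 1 + \<eta> * \<Delta> \<and>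
              finite {t. \<not> (\<exists>v. ((\<lambda>\<tau>. hproj deg (g \<tau>)) has_vector_derivative v) (at t) \<and>
                              norm (v - hproj deg E) \<le> C * \<Delta>)})"
    using assms(4) unfolding deformable_def by (elim exE conjE)
  have bound: "\<bar>?d y 0 - ?d E 0 - m (- E) y \<bullet> E\<bar> \<le> 4 * \<eta> * ?d E y"
    if "\<eta> > 0" and small: "?d E y \<le> min (\<Delta>\<^sub>E \<eta> / 4) (1 / 2)" and "?d E y > 0" for y \<eta>
  proof -
    define q where "q = m (- E) y"
    define D where "D = ?d E y"
    have D: "?d q 0 = D"
      using cc_dist_translate[of E 0 q] cc_dist_sym[of 0 q] by (simp add: q_def D_def)
    have "D > 0" "2 * D < \<Delta>\<^sub>E \<eta>" "D \<le> 1 / 2"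
      using that by (auto simp: D_def)
    define u where "u = dil (1 / D) q"
    \<comment> \<open>The curve is taken with \<open>l = 1/2\<close>, fixed and below \<open>1\<close> so that it passes through
        \<open>E\<^sup>-\<^sup>1\<close> at time \<open>-1\<close>, and with \<open>\<Delta> = 2 D\<close>, so that \<open>\<Delta> l = D\<close> and \<open>u\<close> has norm at most \<open>1\<close>.
        The error \<open>\<eta> \<Delta>\<close> is then a small multiple of \<open>D\<close>.\<close>
    have q: "dil (2 * D * (1 / 2)) u = q" using \<open>D > 0\<close> by (simp add: u_def dilation_dilation)
    have "?d u 0 \<le> 1"
      using cc_dist_dil_le[of "1 / D" q 0] \<open>D > 0\<close> D by (simp add: u_def linear_0[OF linear_dilation])
    then obtain g where g: "cc_lipschitz m deg g" "\<forall>t. \<bar>t\<bar> \<ge> 1 / 2 \<longrightarrow> g t = t *\<^sub>R E"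
      "g (q \<bullet> E) = q" "cc_Lip m deg g \<le> 1 + \<eta> * (2 * D)"
      using curve[rule_format, of "1 / 2" \<eta> "2 * D" u] \<open>D > 0\<close> \<open>2 * D < \<Delta>\<^sub>E \<eta>\<close> \<open>\<eta> > 0\<close> unfolding q by auto
    have \<zeta>: "\<bar>q \<bullet> E\<bar> \<le> D"
    proof -
      have "\<bar>q \<bullet> E\<bar> \<le> norm (hproj deg q) * norm E"
        using Cauchy_Schwarz_ineq2[of "hproj deg q" E] by (simp add: hproj_inner[OF E(1)])
      also have "\<dots> \<le> D"
        using norm_hproj_le_cc_dist[of 0 q] D E by (simp add: linear_0[OF linear_hproj])
      finally show ?thesis .
    qed
    have y: "y = m E q" by (simp add: q_def)
    have "?d y 0 = ?d q (- E)"
      using cc_dist_translate[of E q "- E"] by (simp add: y)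
    also have "\<dots> = ?d (g (q \<bullet> E)) (g (- 1))" using g(2)[rule_format, of "- 1"] g(3) by simp
    also have "\<dots> \<le> cc_Lip m deg g * \<bar>q \<bullet> E - (- 1)\<bar>" by (rule cc_Lip_bound[OF g(1)])
    also have "\<bar>q \<bullet> E - (- 1)\<bar> = 1 + q \<bullet> E" using \<zeta> \<open>D \<le> 1 / 2\<close> by simp
    also have "cc_Lip m deg g * (1 + q \<bullet> E) \<le> (1 + \<eta> * (2 * D)) * (1 + q \<bullet> E)"
      using g(4) \<zeta> \<open>D \<le> 1 / 2\<close> by (intro mult_right_mono) auto
    also have "\<dots> = 1 + q \<bullet> E + 2 * \<eta> * D * (1 + q \<bullet> E)" by (simp add: algebra_simps)
    also have "\<dots> \<le> 1 + q \<bullet> E + 2 * \<eta> * D * 2"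
      using \<zeta> \<open>D \<le> 1 / 2\<close> \<open>D > 0\<close> \<open>\<eta> > 0\<close> by (intro add_left_mono mult_left_mono) auto
    finally have upper: "?d y 0 \<le> 1 + q \<bullet> E + 4 * \<eta> * D" by simp
    have "1 + q \<bullet> E = y \<bullet> E"
      using G_linear_inner[OF E(1)] E(2) by (simp add: y G_linear_def power2_norm_eq_inner[symmetric])
    then have lower: "1 + q \<bullet> E \<le> ?d y 0"
      using inner_le_cc_dist[OF E, of y] by simp
    have "4 * \<eta> * D \<ge> 0" using \<open>D > 0\<close> \<open>\<eta> > 0\<close> by simp
    then show ?thesis
      using upper lower cc_dist_unit_horizontal[OF E] by (simp add: abs_le_iff flip: q_def D_def)
  qed
  have "((\<lambda>y. \<bar>?d y 0 - ?d E 0 - m (- E) y \<bullet> E\<bar> / ?d E y) \<longlongrightarrow> 0) (at E)"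
  proof (rule tendstoI)
    fix e :: real assume "e > 0"
    define \<eta> where "\<eta> = e / 8"
    have "\<eta> > 0" using \<open>e > 0\<close> by (simp add: \<eta>_def)
    then have "min (\<Delta>\<^sub>E \<eta> / 4) (1 / 2) > 0" using pos by simp
    from cc_dist_small[OF this]
    show "\<forall>\<^sub>F y in at E. dist (\<bar>?d y 0 - ?d E 0 - m (- E) y \<bullet> E\<bar> / ?d E y) 0 < e"
    proof (rule eventually_mono)
      fix y assume y: "?d E y \<le> min (\<Delta>\<^sub>E \<eta> / 4) (1 / 2)"
      show "dist (\<bar>?d y 0 - ?d E 0 - m (- E) y \<bullet> E\<bar> / ?d E y) 0 < e"
      \<comment> \<open>If the denominator is \<open>0\<close>, so is the quotient.\<close>
      proof (cases "?d E y = 0")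
        case False
        then have d: "?d E y > 0" using cc_dist_nonneg[of E y] by linarith
        have "\<bar>?d y 0 - ?d E 0 - m (- E) y \<bullet> E\<bar> / ?d E y \<le> 4 * \<eta>"
          using bound[OF \<open>\<eta> > 0\<close> y d] d by (simp add: divide_le_eq)
        also have "\<dots> < e" using \<open>e > 0\<close> by (simp add: \<eta>_def)
        finally show ?thesis using d by (simp add: dist_real_def)
      qed (use \<open>e > 0\<close> in simp)
    qed
  qed
  then show ?thesis
    unfolding pansu_differentiable_def by (intro exI[of _ "\<lambda>x. x \<bullet> E"] conjI G_linear_inner[OF E(1)])
qed


end
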